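(* Let $G$ be a finite connected simple graph (representing a palace) which is solvable, and suppose that the reduction $G^-$ of $G$ has exactly $m$ vertices, where $m\ge 3$. Then $G$ can be solved in $2m-4$ days by a linear strategy, and $G$ cannot be solved in fewer days by any strategy.
   Context: A palace is a finite connected simple graph $G$. The princess spends each day $1,2,3,\dots$ at a vertex of $G$ and each night must move to an adjacent vertex. Each day the prince visits a single vertex of his choice, with no constraint relating the vertices visited on different days and with no information on the position of the princess. The princess is adversarial: she knows in advance the sequence of vertices that the prince will visit. A walk for the princess is a sequence $(w_1,\dots,w_n)$ of vertices of $G$ with $w_i$ adjacent to $w_{i+1}$ for $1\le i<n$. A strategy for the prince of length $n$ is a sequence $(p_1,\dots,p_n)$ of vertices of $G$ ($p_i$ is the vertex visited on day $i$); it is winning (it solves $G$ in $n$ days) if for every walk $(w_1,\dots,w_n)$ in $G$ there is some $i$ with $w_i=p_i$. The graph $G$ is solvable if a winning strategy of some finite length exists. Reduction: a leaf of a graph is removable if it is adjacent to a vertex of degree at least $3$. The reduction $G^-$ of $G$ is the graph obtained by repeatedly removing removable leaves, one at a time, until no removable leaves remain; it is well defined up to graph isomorphism. Linear strategies: every solvable $G$ is a tree, in which any non-leaf vertex lies on, or is adjacent to a vertex of, any given path of maximal length. Let $P$ be a path of maximal length $\ell$ in $G$, with vertices numbered $0,1,\dots,\ell$ in the order in which they appear in $P$. A linear search is a walk of the prince (so vertices visited on consecutive days are adjacent) which begins at vertex $1$ and ends at vertex $\ell-1$, visits all non-leaf vertices of $G$, is never outside $P$ on two consecutive days, never visits a vertex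 in $G\setminus P$ more than once, and never visits a lower-numbered vertex of $P$ after a higher-numbered one. (The numbering of $P$ may be taken in either direction.) A linear strategy is a linear search followed immediately, starting on the next day, by another linear search of the opposite parity. Here, with respect to a proper black-and-white colouring of the vertices of $G$ (the bipartition of the tree), the second search has the opposite parity to the first if the colour visited on odd-numbered days in the second search is the opposite of the colour visited on odd-numbered days in the first search; equivalently, the first vertex of the second search has the same colour as the last vertex of the first search. For instance, the second search may be the reversal of the first, beginning at vertex $\ell-1$ and ending at vertex $1$. *)

theory Defs
  imports "Graph_Theory.Graph_Theory"
begin

text \<open>
  A finite simple graph is a digraph satisfying the locale predicate \<^const>\<open>graph\<close> (finite, symmetric,
  no loops, no parallel arcs). Each undirected edge is a pair of opposite arcs, so the degree of a
  vertex is its \<^const>\<open>out_degree\<close>.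
\<close>

definition leaf :: "('a, 'b) pre_digraph \<Rightarrow> 'a \<Rightarrow> bool" where
  "leaf G v \<longleftrightarrow> v \<in> verts G \<and> out_degree G v = 1"

subsection \<open>The game\<close>

text \<open>
  Strategies have length at least 1. As \<^const>\<open>vwalk\<close> excludes the empty list, the empty strategy
  would otherwise be vacuously winning.
\<close>

definition strategy :: "('a, 'b) pre_digraph \<Rightarrow> 'a list \<Rightarrow> bool" where
  "strategy G ps \<longleftrightarrow> ps \<noteq> [] \<and> set ps \<subseteq> verts G"

definition winning :: "('a, 'b) pre_digraph \<Rightarrow> 'a list \<Rightarrow> bool" where
  "winning G ps \<longleftrightarrow> strategy G ps \<and>
     (\<forall>ws. vwalk ws G \<and> length ws = length ps \<longrightarrow> (\<exists>i < length ps. ws ! i = ps ! i))"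

definition solvable :: "('a, 'b) pre_digraph \<Rightarrow> bool" where
  "solvable G \<longleftrightarrow> (\<exists>ps. winning G ps)"

subsection \<open>Reduction\<close>

definition removable_leaf :: "('a, 'b) pre_digraph \<Rightarrow> 'a \<Rightarrow> bool" where
  "removable_leaf G v \<longleftrightarrow> leaf G v \<and> (\<exists>u. v \<rightarrow>\<^bsub>G\<^esub> u \<and> out_degree G u \<ge> 3)"

definition reduction_step :: "('a, 'b) pre_digraph \<Rightarrow> ('a, 'b) pre_digraph \<Rightarrow> bool" where
  "reduction_step G H \<longleftrightarrow> (\<exists>v. removable_leaf G v \<and> H = pre_digraph.del_vert G v)"

text \<open>The reduction is unique only up to isomorphism, hence a relation.\<close>

definition is_reduction :: "('a, 'b) pre_digraph \<Rightarrow> ('a, 'b) pre_digraph \<Rightarrow> bool" where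
  "is_reduction G H \<longleftrightarrow> reduction_step\<^sup>*\<^sup>* G H \<and> (\<nexists>v. removable_leaf H v)"

subsection \<open>Linear strategies\<close>

definition longest_path :: "('a, 'b) pre_digraph \<Rightarrow> 'a list \<Rightarrow> bool" where
  "longest_path G P \<longleftrightarrow> vpath P G \<and> (\<forall>Q. vpath Q G \<longrightarrow> vwalk_length Q \<le> vwalk_length P)"

text \<open>
  The vertex of \<open>P\<close> numbered \<open>k\<close> is \<open>P ! k\<close>, for \<open>k = 0, \<dots>, \<ell>\<close> with \<open>\<ell> = vwalk_length P\<close>. The
  predicate below uses this numbering; the other direction is obtained from \<open>rev P\<close>.
\<close>

definition linear_search_along :: "('a, 'b) pre_digraph \<Rightarrow> 'a list \<Rightarrow> 'a list \<Rightarrow> bool" where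
  "linear_search_along G P s \<longleftrightarrow>
     vwalk s G \<and>
     hd s = P ! 1 \<and> last s = P ! (vwalk_length P - 1) \<and>
     (\<forall>v \<in> verts G. \<not> leaf G v \<longrightarrow> v \<in> set s) \<and>
     (\<forall>i. Suc i < length s \<longrightarrow> s ! i \<in> set P \<or> s ! Suc i \<in> set P) \<and>
     (\<forall>i j. i < j \<and> j < length s \<and> s ! i \<notin> set P \<longrightarrow> s ! i \<noteq> s ! j) \<and>
     (\<forall>i j a b. i < j \<and> j < length s \<and> a < length P \<and> b < length P \<and>
        s ! i = P ! a \<and> s ! j = P ! b \<longrightarrow> a \<le> b)"

definition linear_search :: "('a, 'b) pre_digraph \<Rightarrow> 'a list \<Rightarrow> 'a list \<Rightarrow> bool" where
  "linear_search G P s \<longleftrightarrow> linear_search_along G P s \<or> linear_search_along G (rev P) s"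

definition proper_2_colouring :: "('a, 'b) pre_digraph \<Rightarrow> ('a \<Rightarrow> bool) \<Rightarrow> bool" where
  "proper_2_colouring G c \<longleftrightarrow> (\<forall>u v. u \<rightarrow>\<^bsub>G\<^esub> v \<longrightarrow> c u \<noteq> c v)"

text \<open>
  For the search \<open>t\<close> performed immediately after the search \<open>s\<close>. Colours alternate along a walk, so
  if the first vertex of \<open>t\<close> repeats the colour of the last vertex of \<open>s\<close>, then the colour visited
  on odd-numbered days is switched from \<open>s\<close> to \<open>t\<close>.
\<close>

definition opposite_parity :: "('a, 'b) pre_digraph \<Rightarrow> 'a list \<Rightarrow> 'a list \<Rightarrow> bool" where
  "opposite_parity G s t \<longleftrightarrow> (\<exists>c. proper_2_colouring G c \<and> c (hd t) = c (last s))"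

definition linear_strategy :: "('a, 'b) pre_digraph \<Rightarrow> 'a list \<Rightarrow> 'a list \<Rightarrow> bool" where
  "linear_strategy G P ps \<longleftrightarrow>
     (\<exists>s t. ps = s @ t \<and> linear_search G P s \<and> linear_search G P t \<and> opposite_parity G s t)"

lemma longest_path_exists:
  assumes "graph G" "connected G"
  shows "\<exists>P. longest_path G P"
proof -
  interpret graph G by fact
  have "verts G \<noteq> {}"
    using assms(2) by (simp add: connected_def strongly_connected_def mk_symmetric_def)
  then obtain v where "v \<in> verts G" by blast
  then have v: "vpath [v] G" by (simp add: vpath_def vwalk_def)
  have "vwalk_length Q \<le> card (verts G)" if "vpath Q G" for Q
  proof -
    have "set Q \<subseteq> verts G" "distinct Q" using that by (simp_all add: vpath_def vwalk_def)
    then have "length Q \<le> card (verts G)"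
      by (metis card_mono distinct_card finite_verts)
    then show ?thesis by simp
  qed
  then have "\<exists>P. vpath P G \<and> (\<forall>Q. vpath Q G \<longrightarrow> vwalk_length Q \<le> vwalk_length P)"
    using v by (intro ex_has_greatest_nat[where b = "Suc (card (verts G))" and k = "[v]"]) (auto simp: less_Suc_eq_le)
  then show ?thesis unfolding longest_path_def .
qed

end

theory Submission
  imports Defs
begin

text \<open>
  Let \<open>N\<close> be the set of nonleaf vertices and \<open>k(u)\<close> the number of neighbours of \<open>u\<close> in \<open>N\<close>. Reduction changes
  neither, and leaves exactly \<open>max(0, 2 - k(u))\<close> leaves at each \<open>u \<in> N\<close>; this determines \<open>m\<close>.

  Lower bound: if \<open>u\<close> is visited fewer than \<open>k(u) - 1\<close> times on days of a given parity, the princess survives by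
  standing on \<open>u\<close> on those days and stepping aside, into one of the \<open>k(u)\<close> branches, whenever the
  prince comes: during a run of consecutive visits there is a branch whose entrance he never checks.
  Hence each \<open>u\<close> needs \<open>max(1, k(u) - 1)\<close> visits for each of the two parities.

  Three branches of length 3 suffice to survive any run, and so does a cycle. So a solvable palace is a
  tree in which all nonleaf vertices off a longest path \<open>P\<close> are adjacent to the inner vertices of \<open>P\<close>, and have no
  other nonleaf neighbour. The search that walks along \<open>P\<close>, with one detour to each of them, visits every vertex
  exactly as often as the lower bound requires, and catches a princess who starts in the colour class of the prince.
  The same search along \<open>rev P\<close> catches her otherwise.
\<close>

text \<open>As a classical elimination rule it makes the automation unfold every adjacency into arcs.\<close>

declare reachableE [rule del]

section \<open>Evading the prince\<close>

lemma vwalk_map_upt: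
  assumes "n > 0" and "\<And>i. w i \<in> verts G" and "\<And>i. w i \<rightarrow>\<^bsub>G\<^esub> w (Suc i)"
  shows "vwalk (map w [0..<n]) G"
  using assms(1)
proof (induction n rule: nat_induct_non_zero)
  case 1
  then show ?case using assms(2) by (simp add: vwalk_def)
next
  case (Suc n)
  then show ?case
    using assms(2) assms(3)[of "n - 1"]
    by (auto simp: vwalk_def set_vwalk_arcs_snoc last_map)
qed

text \<open>Infinite walks free the evasion constructions from bookkeeping of lengths: cut off after
  \<open>length ps\<close> days, \<open>w\<close> becomes an ordinary walk, which a winning strategy
  has to meet.\<close>

lemma (in wf_digraph) winning_meets_walk:
  assumes "winning G ps" and "\<And>i. w i \<rightarrow>\<^bsub>G\<^esub> w (Suc i)"
  shows "\<exists>i < length ps. w i = ps ! i"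
proof -
  have "vwalk (map w [0..<length ps]) G"
  proof (rule vwalk_map_upt)
    show "0 < length ps" using assms(1) by (simp add: winning_def strategy_def)
    show "w i \<in> verts G" for i using assms(2) by (rule adj_in_verts(1))
  qed (rule assms(2))
  then obtain i where "i < length ps" "map w [0..<length ps] ! i = ps ! i"
    using assms(1) unfolding winning_def by (metis length_map length_upt diff_zero)
  then show ?thesis by auto
qed

text \<open>The prince blocks at most one of the two ways out that she has each night.\<close>

lemma (in wf_digraph) winning_imp_not_min_degree_2:
  assumes "winning G ps" and "C \<noteq> {}"
    and deg: "\<And>v. v \<in> C \<Longrightarrow> \<exists>a\<in>C. \<exists>b\<in>C. a \<noteq> b \<and> v \<rightarrow>\<^bsub>G\<^esub> a \<and> v \<rightarrow>\<^bsub>G\<^esub> b"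
  shows False
proof -
  have start: "\<exists>v. v \<in> C \<and> v \<noteq> ps ! 0"
    using assms(2) deg by blast
  have step: "\<exists>b. (b \<in> C \<and> b \<noteq> ps ! Suc i) \<and> v \<rightarrow>\<^bsub>G\<^esub> b" if "v \<in> C \<and> v \<noteq> ps ! i" for v i
    using deg[of v] that by metis
  obtain w where w: "\<And>i. (w i \<in> C \<and> w i \<noteq> ps ! i) \<and> w i \<rightarrow>\<^bsub>G\<^esub> w (Suc i)"
    using dependent_nat_choice[of "\<lambda>i v. v \<in> C \<and> v \<noteq> ps ! i" "\<lambda>_ v b. v \<rightarrow>\<^bsub>G\<^esub> b", OF start step]
    by blast
  then show False using winning_meets_walk[OF assms(1), of w] by blast
qed

text \<open>
  The princess wants to be at \<open>c\<close> on every even day \<open>2 * j\<close> on which the prince is not there. A maximal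
  run of blocked even days is identified by the value that \<open>next_free\<close> takes on it. Throughout the run she
  hides at some \<open>y\<close> at distance 2, entering and leaving through the same neighbour \<open>x\<close> of \<open>c\<close>.
\<close>

definition next_free :: "'a \<Rightarrow> (nat \<Rightarrow> 'a) \<Rightarrow> nat \<Rightarrow> nat" where
  "next_free c p j = (LEAST k. j \<le> k \<and> p (2 * k) \<noteq> c)"

lemma next_free_props:
  assumes "\<exists>k\<ge>j. p (2 * k) \<noteq> c"
  shows "j \<le> next_free c p j" "p (2 * next_free c p j) \<noteq> c"
  using LeastI_ex[of "\<lambda>k. j \<le> k \<and> p (2 * k) \<noteq> c"] assms unfolding next_free_def by auto

lemma next_free_le: "j \<le> k \<Longrightarrow> p (2 * k) \<noteq> c \<Longrightarrow> next_free c p j \<le> k"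
  unfolding next_free_def by (rule Least_le) simp

lemma next_free_blocked: "p (2 * j) = c \<Longrightarrow> next_free c p (Suc j) = next_free c p j"
  unfolding next_free_def by (rule arg_cong[where f = Least]) (auto simp: fun_eq_iff Suc_le_eq le_less)

lemma next_free_free: "p (2 * j) \<noteq> c \<Longrightarrow> next_free c p j = j"
  unfolding next_free_def by (rule Least_equality) auto

text \<open>The odd day \<open>2 * j + 1\<close> is charged to the run of the even day after it,
  hence the index \<open>next_free c p (Suc j)\<close>. Between two blocked even days she only needs
  some neighbour \<open>z\<close> of the hiding place \<open>y\<close> that the prince misses; on
  all other odd days she stands at the entrance \<open>x\<close>. One choice of \<open>x\<close> and
  \<open>y\<close> serves a whole run, so the choices for different runs are independent.\<close>

lemma (in sym_digraph) evade_run_choice: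
  assumes run: "\<And>k. \<exists>x y. c \<rightarrow>\<^bsub>G\<^esub> x \<and> x \<rightarrow>\<^bsub>G\<^esub> y \<and> y \<noteq> c \<and>
      (\<forall>j. next_free c p (Suc j) = k \<longrightarrow>
         (if p (2 * j) = c \<and> p (2 * Suc j) = c then \<exists>z. y \<rightarrow>\<^bsub>G\<^esub> z \<and> z \<noteq> p (2 * j + 1)
          else x \<noteq> p (2 * j + 1)))"
  shows "\<exists>w. \<forall>i. w i \<rightarrow>\<^bsub>G\<^esub> w (Suc i) \<and> w i \<noteq> p i"
proof -
  have sym: "v \<rightarrow>\<^bsub>G\<^esub> u" if "u \<rightarrow>\<^bsub>G\<^esub> v" for u v
    using that sym_arcs by (metis arcs_ends_symmetric)
  let ?n = "next_free c p"
  define R where "R k x y \<longleftrightarrow> c \<rightarrow>\<^bsub>G\<^esub> x \<and> x \<rightarrow>\<^bsub>G\<^esub> y \<and> y \<noteq> c \<and>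
      (\<forall>j. ?n (Suc j) = k \<longrightarrow>
         (if p (2 * j) = c \<and> p (2 * Suc j) = c then \<exists>z. y \<rightarrow>\<^bsub>G\<^esub> z \<and> z \<noteq> p (2 * j + 1)
          else x \<noteq> p (2 * j + 1)))" for k x y
  have "\<forall>k. \<exists>x y. R k x y" using run unfolding R_def by blast
  then obtain x y where R: "\<And>k. R k (x k) (y k)" by metis
  then have xy: "\<And>k. c \<rightarrow>\<^bsub>G\<^esub> x k" "\<And>k. x k \<rightarrow>\<^bsub>G\<^esub> y k" "\<And>k. y k \<noteq> c"
    unfolding R_def by blast+
  have xj: "x (?n (Suc j)) \<noteq> p (2 * j + 1)" if "\<not> (p (2 * j) = c \<and> p (2 * Suc j) = c)" for j
    using R[of "?n (Suc j)"] that unfolding R_def by metis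
  define z where "z j = (SOME z. y (?n (Suc j)) \<rightarrow>\<^bsub>G\<^esub> z \<and> z \<noteq> p (2 * j + 1))" for j
  have z: "y (?n (Suc j)) \<rightarrow>\<^bsub>G\<^esub> z j \<and> z j \<noteq> p (2 * j + 1)" if "p (2 * j) = c" "p (2 * Suc j) = c" for j
    unfolding z_def by (rule someI_ex) (use R[of "?n (Suc j)"] that in \<open>auto simp: R_def\<close>)
  \<comment> \<open>\<open>e j\<close> is her place on day \<open>2 * j\<close> and
    \<open>d j\<close> her place on the odd day after it.\<close>
  define e where "e j = (if p (2 * j) = c then y (?n j) else c)" for j
  define d where "d j = (if p (2 * j) = c \<and> p (2 * Suc j) = c then z j else x (?n (Suc j)))" for j
  define w where "w i = (if even i then e (i div 2) else d (i div 2))" for i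
  have w: "w (2 * j) = e j" "w (Suc (2 * j)) = d j" for j by (simp_all add: w_def)
  \<comment> \<open>The odd days just before and just after a blocked even day are charged to the
    same run, so the same \<open>x\<close> and \<open>y\<close> are in force on both sides of
    it.\<close>
  have n: "?n (Suc j) = ?n j" if "p (2 * j) = c" for j using that by (rule next_free_blocked)
  have "w (2 * j) \<rightarrow>\<^bsub>G\<^esub> w (Suc (2 * j)) \<and> w (2 * j) \<noteq> p (2 * j)" for j
    using xy z[of j] sym n[of j] by (auto simp: w e_def d_def)
  moreover have "w (Suc (2 * j)) \<rightarrow>\<^bsub>G\<^esub> w (Suc (Suc (2 * j))) \<and> w (Suc (2 * j)) \<noteq> p (Suc (2 * j))" for j
    using xy z[of j] sym xj[of j] w(1)[of "Suc j"] by (auto simp: w e_def d_def)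
  ultimately have "w i \<rightarrow>\<^bsub>G\<^esub> w (Suc i) \<and> w i \<noteq> p i" for i
    by (cases "even i") (auto elim!: evenE oddE)
  then show ?thesis by blast
qed

lemma next_free_exists:
  fixes p :: "nat \<Rightarrow> 'a"
  assumes "finite {j. p (2 * j) = c}"
  shows "\<exists>k\<ge>j. p (2 * k) \<noteq> c"
proof -
  obtain m where "\<forall>i\<in>{j. p (2 * j) = c}. i < m"
    using assms by (auto simp: finite_nat_set_iff_bounded)
  then have "p (2 * max j m) \<noteq> c" by (metis max.cobounded2 linorder_not_less mem_Collect_eq)
  then show ?thesis by (intro exI[of _ "max j m"]) simp
qed

text \<open>Of the odd days charged to a run, at most two are not enclosed by blocked days: the one
  following the free day before the run, and the one preceding the free day \<open>k\<close>. These
  are the days on which she enters and leaves.\<close>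

lemma next_free_ends_card:
  assumes fin: "finite {j. p (2 * j) = c}"
  shows "card {j. next_free c p (Suc j) = k \<and> \<not> (p (2 * j) = c \<and> p (2 * Suc j) = c)} \<le> 2"
    (is "card ?J \<le> 2")
proof -
  have ex: "\<exists>k\<ge>j. p (2 * k) \<noteq> c" for j
    using next_free_exists[OF fin] .
  have J: "j < k \<and> (j = k - 1 \<or> p (2 * j) \<noteq> c)" if "j \<in> ?J" for j
  proof -
    from that have k: "next_free c p (Suc j) = k" by simp
    have "p (2 * Suc j) \<noteq> c \<Longrightarrow> k = Suc j" using k next_free_free[of p "Suc j" c] by simp
    then show ?thesis using that next_free_props(1)[OF ex, of "Suc j"] k by auto
  qed
  have uniq: "i = j" if "i \<in> ?J" "j \<in> ?J" "p (2 * i) \<noteq> c" "p (2 * j) \<noteq> c" for i j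
  proof (rule ccontr)
    assume "i \<noteq> j"
    have "\<not> a < b" if "a \<in> ?J" "b \<in> ?J" "p (2 * b) \<noteq> c" for a b
    proof
      assume "a < b"
      then have "next_free c p (Suc a) \<le> b" using that by (intro next_free_le) auto
      then show False using that J[of b] by auto
    qed
    then show False using that \<open>i \<noteq> j\<close> by (meson nat_neq_iff)
  qed
  have "\<exists>a. ?J \<subseteq> {k - 1, a}"
  proof (cases "\<exists>a\<in>?J. p (2 * a) \<noteq> c")
    case True
    then obtain a where "a \<in> ?J" "p (2 * a) \<noteq> c" by blast
    then have "?J \<subseteq> {k - 1, a}" using J uniq by blast
    then show ?thesis by blast
  next
    case False
    then have "?J \<subseteq> {k - 1, k}" using J by blast
    then show ?thesis by blast
  qed
  then obtain a where "?J \<subseteq> {k - 1, a}" by blast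
  then have "card ?J \<le> card {k - 1, a}" by (rule card_mono[rotated]) simp
  also have "\<dots> \<le> 2" by (simp add: card_insert_if)
  finally show ?thesis .
qed

text \<open>If \<open>j\<close> is charged to \<open>k\<close>, then \<open>Suc j\<close> is either
  a blocked index or \<open>k\<close> itself, which accounts for the extra one.\<close>

lemma next_free_card:
  assumes fin: "finite {j. p (2 * j) = c}"
  shows "finite {j. next_free c p (Suc j) = k}"
    and "card {j. next_free c p (Suc j) = k} \<le> Suc (card {j. p (2 * j) = c})"
proof -
  let ?J = "{j. next_free c p (Suc j) = k}" and ?R = "{j. p (2 * j) = c}"
  have "Suc ` ?J \<subseteq> insert k ?R" using next_free_free[of p _ c] by fastforce
  then have *: "finite (Suc ` ?J)" "card (Suc ` ?J) \<le> card (insert k ?R)"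
    using fin by (auto intro: finite_subset card_mono)
  show "finite ?J" using *(1) by (simp add: finite_image_iff)
  show "card ?J \<le> Suc (card ?R)"
    using *(2) card_insert_le_m1[of "Suc (card ?R)" ?R k] by (simp add: card_image)
qed

text \<open>In a branch of length 2 she can only shuttle between \<open>x\<close> and
  \<open>y\<close>, so \<open>x\<close> has to be missed by the prince on every odd day charged to
  the run. These days exclude fewer vertices than \<open>X\<close> has.\<close>

lemma (in sym_digraph) evade_many_branches:
  assumes fin: "finite {j. p (2 * j) = c}"
    and X: "\<And>x. x \<in> X \<Longrightarrow> c \<rightarrow>\<^bsub>G\<^esub> x \<and> (\<exists>y. y \<noteq> c \<and> x \<rightarrow>\<^bsub>G\<^esub> y)"
    and card: "Suc (card {j. p (2 * j) = c}) < card X"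
  shows "\<exists>w. \<forall>i. w i \<rightarrow>\<^bsub>G\<^esub> w (Suc i) \<and> w i \<noteq> p i"
proof (rule evade_run_choice)
  fix k
  let ?J = "{j. next_free c p (Suc j) = k}"
  have "card ((\<lambda>j. p (2 * j + 1)) ` ?J) < card X"
    using card_image_le[OF next_free_card(1)[OF fin, of k], of "\<lambda>j. p (2 * j + 1)"] next_free_card(2)[OF fin, of k] card
    by linarith
  then have "\<not> X \<subseteq> (\<lambda>j. p (2 * j + 1)) ` ?J"
    using card_mono[of "(\<lambda>j. p (2 * j + 1)) ` ?J" X] next_free_card(1)[OF fin, of k] by auto
  then obtain x where x: "x \<in> X" "x \<notin> (\<lambda>j. p (2 * j + 1)) ` ?J" by blast
  obtain y where y: "y \<noteq> c" "x \<rightarrow>\<^bsub>G\<^esub> y" using X x(1) by blast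
  have "y \<rightarrow>\<^bsub>G\<^esub> x" using y(2) sym_arcs by (metis arcs_ends_symmetric)
  then show "\<exists>x y. c \<rightarrow>\<^bsub>G\<^esub> x \<and> x \<rightarrow>\<^bsub>G\<^esub> y \<and> y \<noteq> c \<and>
      (\<forall>j. next_free c p (Suc j) = k \<longrightarrow>
         (if p (2 * j) = c \<and> p (2 * Suc j) = c then \<exists>z. y \<rightarrow>\<^bsub>G\<^esub> z \<and> z \<noteq> p (2 * j + 1)
          else x \<noteq> p (2 * j + 1)))"
    using x y X by (intro exI[of _ x] exI[of _ y]) auto
qed

text \<open>A second neighbour \<open>z\<close> of \<open>y\<close> lets her dodge between
  \<open>x\<close> and \<open>z\<close> during the run, so \<open>x\<close> has to be missed only
  when she enters and when she leaves. Three branches therefore suffice, however long the run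
  is.\<close>

lemma (in sym_digraph) evade_long_branches:
  assumes fin: "finite {j. p (2 * j) = c}"
    and X: "\<And>x. x \<in> X \<Longrightarrow> c \<rightarrow>\<^bsub>G\<^esub> x \<and> (\<exists>y. y \<noteq> c \<and> x \<rightarrow>\<^bsub>G\<^esub> y \<and> (\<exists>z. z \<noteq> x \<and> y \<rightarrow>\<^bsub>G\<^esub> z))"
    and card: "3 \<le> card X"
  shows "\<exists>w. \<forall>i. w i \<rightarrow>\<^bsub>G\<^esub> w (Suc i) \<and> w i \<noteq> p i"
proof (rule evade_run_choice)
  fix k
  let ?J = "{j. next_free c p (Suc j) = k \<and> \<not> (p (2 * j) = c \<and> p (2 * Suc j) = c)}"
  have J: "finite ?J" by (rule finite_subset[OF _ next_free_card(1)[OF fin, of k]]) blast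
  have "card ((\<lambda>j. p (2 * j + 1)) ` ?J) < card X"
    using card_image_le[OF J, of "\<lambda>j. p (2 * j + 1)"] next_free_ends_card[OF fin, of k] card
    by linarith
  then have "\<not> X \<subseteq> (\<lambda>j. p (2 * j + 1)) ` ?J"
    using card_mono[of "(\<lambda>j. p (2 * j + 1)) ` ?J" X] J by auto
  then obtain x where x: "x \<in> X" "x \<notin> (\<lambda>j. p (2 * j + 1)) ` ?J" by blast
  obtain y z where y: "y \<noteq> c" "x \<rightarrow>\<^bsub>G\<^esub> y" and z: "z \<noteq> x" "y \<rightarrow>\<^bsub>G\<^esub> z" using X x(1) by blast
  have "y \<rightarrow>\<^bsub>G\<^esub> x" using y(2) sym_arcs by (metis arcs_ends_symmetric)
  then have "\<exists>z'. y \<rightarrow>\<^bsub>G\<^esub> z' \<and> z' \<noteq> q" for q using z by metis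
  then show "\<exists>x y. c \<rightarrow>\<^bsub>G\<^esub> x \<and> x \<rightarrow>\<^bsub>G\<^esub> y \<and> y \<noteq> c \<and>
      (\<forall>j. next_free c p (Suc j) = k \<longrightarrow>
         (if p (2 * j) = c \<and> p (2 * Suc j) = c then \<exists>z. y \<rightarrow>\<^bsub>G\<^esub> z \<and> z \<noteq> p (2 * j + 1)
          else x \<noteq> p (2 * j + 1)))"
    using x y X by (intro exI[of _ x] exI[of _ y]) auto
qed

section \<open>Visits forced on the prince, counted by parity of the day\<close>

definition visits :: "'a list \<Rightarrow> nat \<Rightarrow> 'a \<Rightarrow> nat set" where
  "visits ps b c = {i. i < length ps \<and> i mod 2 = b \<and> ps ! i = c}"

lemma (in wf_digraph) winning_shift:
  assumes "winning G ps" and "d \<noteq> c" and "b < 2"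
  shows "\<exists>p. finite {j. p (2 * j) = c} \<and> card {j. p (2 * j) = c} \<le> card (visits ps b c) \<and>
    (\<forall>w. (\<forall>i. w i \<rightarrow>\<^bsub>G\<^esub> w (Suc i)) \<longrightarrow> (\<exists>i. w i = p i))"
proof -
  \<comment> \<open>Delaying the strategy by \<open>b\<close> days turns its days of parity
    \<open>b\<close> into even days; the filler \<open>d\<close> differs from \<open>c\<close>, so
    it adds no visit to \<open>c\<close>.\<close>
  define p where "p i = (if b \<le> i \<and> i - b < length ps then ps ! (i - b) else d)" for i
  let ?R = "{j. p (2 * j) = c}"
  have sub: "(\<lambda>j. 2 * j - b) ` ?R \<subseteq> visits ps b c"
  proof
    fix i assume "i \<in> (\<lambda>j. 2 * j - b) ` ?R"
    then obtain j where j: "i = 2 * j - b" "p (2 * j) = c" by blast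
    then have "b \<le> 2 * j" "2 * j - b < length ps" "ps ! (2 * j - b) = c"
      using assms(2) by (simp_all add: p_def split: if_splits)
    moreover have "(2 * j - b) mod 2 = b"
      using \<open>b \<le> 2 * j\<close> \<open>b < 2\<close> by (cases j) (auto simp: less_2_cases_iff)
    ultimately show "i \<in> visits ps b c" by (simp add: visits_def j(1))
  qed
  have "b \<le> 2 * j" if "j \<in> ?R" for j
    using that assms(2) by (simp add: p_def split: if_splits)
  then have inj: "inj_on (\<lambda>j. 2 * j - b) ?R"
    by (intro inj_onI) (metis eq_diff_iff mult_cancel1 zero_neq_numeral)
  have fin: "finite (visits ps b c)" by (simp add: visits_def)
  have "finite ?R" using inj_on_finite[OF inj sub fin] .
  moreover have "card ?R \<le> card (visits ps b c)"
    using card_inj_on_le[OF inj sub fin] .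
  moreover have "\<exists>i. w i = p i" if w: "\<And>i. w i \<rightarrow>\<^bsub>G\<^esub> w (Suc i)" for w
  proof -
    obtain i where "i < length ps" "w (i + b) = ps ! i"
      using winning_meets_walk[OF assms(1), of "\<lambda>i. w (i + b)"] w by (metis add_Suc)
    then show ?thesis by (intro exI[of _ "i + b"]) (simp add: p_def)
  qed
  ultimately show ?thesis by (intro exI[of _ p]) simp
qed

lemma (in sym_digraph) winning_card_visits:
  assumes "winning G ps" and "b < 2"
    and X: "\<And>x. x \<in> X \<Longrightarrow> c \<rightarrow>\<^bsub>G\<^esub> x \<and> (\<exists>y. y \<noteq> c \<and> x \<rightarrow>\<^bsub>G\<^esub> y)"
  shows "card X \<le> Suc (card (visits ps b c))"
proof (rule ccontr)
  assume less: "\<not> ?thesis"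
  then have "X \<noteq> {}" by auto
  then obtain d where "d \<noteq> c" using X by blast
  then obtain p where p: "finite {j. p (2 * j) = c}" "card {j. p (2 * j) = c} \<le> card (visits ps b c)"
      "\<And>w. (\<And>i. w i \<rightarrow>\<^bsub>G\<^esub> w (Suc i)) \<Longrightarrow> \<exists>i. w i = p i"
    using winning_shift[OF assms(1) _ assms(2)] by blast
  have "Suc (card {j. p (2 * j) = c}) < card X" using less p(2) by linarith
  from evade_many_branches[OF p(1) X this]
  obtain w where "\<And>i. w i \<rightarrow>\<^bsub>G\<^esub> w (Suc i)" "\<And>i. w i \<noteq> p i" by blast
  then show False using p(3)[of w] by blast
qed

lemma (in sym_digraph) winning_no_long_branches:
  assumes "winning G ps"
    and X: "\<And>x. x \<in> X \<Longrightarrow> c \<rightarrow>\<^bsub>G\<^esub> x \<and> (\<exists>y. y \<noteq> c \<and> x \<rightarrow>\<^bsub>G\<^esub> y \<and> (\<exists>z. z \<noteq> x \<and> y \<rightarrow>\<^bsub>G\<^esub> z))"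
  shows "card X < 3"
proof (rule ccontr)
  assume less: "\<not> ?thesis"
  then have "X \<noteq> {}" by auto
  then obtain d where "d \<noteq> c" using X by blast
  then obtain p where p: "finite {j. p (2 * j) = c}"
      "\<And>w. (\<And>i. w i \<rightarrow>\<^bsub>G\<^esub> w (Suc i)) \<Longrightarrow> \<exists>i. w i = p i"
    using winning_shift[OF assms(1) _ zero_less_numeral] by blast
  have "3 \<le> card X" using less by simp
  from evade_long_branches[OF p(1) X this]
  obtain w where "\<And>i. w i \<rightarrow>\<^bsub>G\<^esub> w (Suc i)" "\<And>i. w i \<noteq> p i" by blast
  then show False using p(2)[of w] by blast
qed

text \<open>Otherwise she stands at \<open>c\<close> on all days of parity \<open>b\<close> and in
  between takes whichever of \<open>x\<close> and \<open>y\<close> the prince leaves free. This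
  gives the one necessary visit where the bound of \<open>winning_card_visits\<close> is
  zero.\<close>

lemma (in sym_digraph) winning_visits_nonempty:
  assumes "winning G ps" and "b < 2"
    and x: "x \<noteq> y" "c \<rightarrow>\<^bsub>G\<^esub> x" "c \<rightarrow>\<^bsub>G\<^esub> y"
  shows "visits ps b c \<noteq> {}"
proof
  assume empty: "visits ps b c = {}"
  obtain d where "d \<noteq> c" using x(1) by metis
  then obtain p where p: "finite {j. p (2 * j) = c}" "card {j. p (2 * j) = c} \<le> card (visits ps b c)"
      "\<And>w. (\<And>i. w i \<rightarrow>\<^bsub>G\<^esub> w (Suc i)) \<Longrightarrow> \<exists>i. w i = p i"
    using winning_shift[OF assms(1) _ assms(2)] by blast
  define w where "w i = (if even i then c else if x = p i then y else x)" for i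
  have "w i \<rightarrow>\<^bsub>G\<^esub> w (Suc i)" for i
    using x(2,3) arcs_ends_symmetric[OF sym_arcs] by (auto simp: w_def)
  moreover have "w i \<noteq> p i" for i
    using x(1) p(1,2) empty by (auto simp: w_def elim!: evenE)
  ultimately show False using p(3)[of w] by blast
qed

lemma sum_visits_le:
  assumes "finite N"
  shows "(\<Sum>c\<in>N. card (visits ps 0 c) + card (visits ps 1 c)) \<le> length ps"
proof -
  have fin: "finite (visits ps b c)" for b c by (simp add: visits_def)
  have "(\<Sum>c\<in>N. card (visits ps 0 c) + card (visits ps 1 c)) = (\<Sum>c\<in>N. card (visits ps 0 c \<union> visits ps 1 c))"
    by (rule sum.cong[OF refl], rule card_Un_disjoint[symmetric]) (auto simp: visits_def)
  also have "\<dots> = card (\<Union>c\<in>N. visits ps 0 c \<union> visits ps 1 c)"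
    by (rule card_UN_disjoint[symmetric]) (use assms in \<open>auto simp: visits_def\<close>)
  also have "\<dots> \<le> card {..<length ps}"
    by (rule card_mono) (auto simp: visits_def)
  finally show ?thesis by simp
qed

section \<open>The structure of solvable palaces\<close>

definition nonleaves :: "('a, 'b) pre_digraph \<Rightarrow> 'a set" where
  "nonleaves G = {v \<in> verts G. \<not> leaf G v}"

section \<open>Neighbours, walks and connectivity; acyclicity and colouring\<close>

context graph
begin

lemma adj_sym: "u \<rightarrow> v \<Longrightarrow> v \<rightarrow> u"
  using sym_arcs by (rule arcs_ends_symmetric)

lemma adj_neq: "u \<rightarrow> v \<Longrightarrow> u \<noteq> v"
  using adj_not_same by blast

lemma finite_neighbours [simp]: "finite {u. v \<rightarrow> u}"
  by (rule finite_subset[OF _ finite_verts]) (auto dest: adj_in_verts)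

lemma out_degree_eq_card_neighbours: "out_degree G v = card {u. v \<rightarrow> u}"
proof -
  have "{u. v \<rightarrow> u} = head G ` out_arcs G v"
    by (auto simp: arcs_ends_conv out_arcs_def)
  moreover have "inj_on (head G) (out_arcs G v)"
    using no_multi_arcs by (auto simp: inj_on_def arc_to_ends_def)
  ultimately show ?thesis by (simp add: out_degree_def card_image)
qed

lemma leaf_unique_neighbour: "leaf G v \<Longrightarrow> v \<rightarrow> x \<Longrightarrow> v \<rightarrow> y \<Longrightarrow> x = y"
  by (metis leaf_def out_degree_eq_card_neighbours card_1_singletonE mem_Collect_eq singletonD)

text \<open>An isolated vertex is also no leaf in the sense of \<open>leaf\<close>; the given
  neighbour \<open>x\<close> excludes degree 0, so the degree is at least 2.\<close>

lemma nonleaf_other_neighbour: "\<not> leaf G v \<Longrightarrow> v \<rightarrow> x \<Longrightarrow> \<exists>y. y \<noteq> x \<and> v \<rightarrow> y"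
proof (rule ccontr)
  assume v: "\<not> leaf G v" "v \<rightarrow> x" "\<nexists>y. y \<noteq> x \<and> v \<rightarrow> y"
  then have "{u. v \<rightarrow> u} = {x}" by auto
  then show False using v adj_in_verts by (auto simp: leaf_def out_degree_eq_card_neighbours)
qed

lemma two_neighbours_nonleaf: "v \<rightarrow> x \<Longrightarrow> v \<rightarrow> y \<Longrightarrow> x \<noteq> y \<Longrightarrow> \<not> leaf G v"
  using leaf_unique_neighbour by blast

lemma vwalk_iff_nth:
  "vwalk xs G \<longleftrightarrow> xs \<noteq> [] \<and> set xs \<subseteq> verts G \<and> (\<forall>i. Suc i < length xs \<longrightarrow> xs ! i \<rightarrow> xs ! Suc i)"
proof (induction xs rule: vwalk_arcs.induct)
  case (3 x y xs)
  have "vwalk (x # y # xs) G \<longleftrightarrow> x \<in> verts G \<and> x \<rightarrow> y \<and> vwalk (y # xs) G"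
    by (auto simp: vwalk_def)
  also have "\<dots> \<longleftrightarrow> (x # y # xs) \<noteq> [] \<and> set (x # y # xs) \<subseteq> verts G \<and>
      (\<forall>i. Suc i < length (x # y # xs) \<longrightarrow> (x # y # xs) ! i \<rightarrow> (x # y # xs) ! Suc i)"
    unfolding 3 by (auto simp: less_Suc_eq_0_disj)
  finally show ?case .
qed (auto simp: vwalk_def)

lemma vwalk_append_iff:
  assumes "xs \<noteq> []" "ys \<noteq> []"
  shows "vwalk (xs @ ys) G \<longleftrightarrow> vwalk xs G \<and> vwalk ys G \<and> last xs \<rightarrow> hd ys"
  using assms by (auto simp: vwalk_def vwalk_arcs_append)

lemma vwalk_rev: "vwalk xs G \<Longrightarrow> vwalk (rev xs) G"
proof (induction xs rule: vwalk_induct)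
  case (Cons u v es)
  then have "v \<in> verts G" "u \<in> verts G" "v \<rightarrow> u" using adj_in_verts adj_sym by auto
  then show ?case
    using Cons vwalk_append_iff[of "rev (v # es)" "[u]"] by (simp add: vwalk_def)
qed (simp add: vwalk_def)

lemma longest_path_rev: "longest_path G P \<Longrightarrow> longest_path G (rev P)"
  by (auto simp: longest_path_def vpath_def vwalk_rev)

text \<open>Packages the induction along reachability: an argument from connectivity then only has
  to exhibit a set closed under adjacency.\<close>

lemma connected_closed_eq_verts:
  assumes "connected G" "u \<in> B" "B \<subseteq> verts G" "\<And>x y. x \<in> B \<Longrightarrow> x \<rightarrow> y \<Longrightarrow> y \<in> B"
  shows "B = verts G"
proof -
  have sc: "strongly_connected G" using assms(1) sym_arcs by (simp add: symmetric_connected_imp_strongly_connected)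
  have "v \<in> B" if "v \<in> verts G" for v
  proof -
    have "u \<rightarrow>\<^sup>* v" using sc assms(2,3) that by (auto simp: strongly_connected_def)
    then show ?thesis by (induction rule: reachable_induct) (use assms in auto)
  qed
  then show ?thesis using assms(3) by blast
qed

lemma connected_has_neighbour:
  assumes "connected G" "3 \<le> card (verts G)" "v \<in> verts G"
  shows "\<exists>u. v \<rightarrow> u"
proof (rule ccontr)
  assume "\<nexists>u. v \<rightarrow> u"
  then have "{v} = verts G" using assms(3) by (intro connected_closed_eq_verts[OF assms(1)]) auto
  then have "card (verts G) = card {v}" by simp
  then show False using assms(2) by simp
qed

lemma connected_leaf_neighbour:
  assumes "connected G" "3 \<le> card (verts G)" "leaf G u" "u \<rightarrow> v"
  shows "\<not> leaf G v"
proof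
  assume v: "leaf G v"
  have "{u, v} = verts G"
  proof (rule connected_closed_eq_verts[OF assms(1), of u])
    show "{u, v} \<subseteq> verts G" using adj_in_verts[OF assms(4)] by simp
    show "y \<in> {u, v}" if "x \<in> {u, v}" "x \<rightarrow> y" for x y
      using that leaf_unique_neighbour[OF assms(3,4)] leaf_unique_neighbour[OF v adj_sym[OF assms(4)]] by blast
  qed simp
  then have "card (verts G) \<le> 2" using card_length[of "[u, v]"] by simp
  then show False using assms(2) by simp
qed

text \<open>With at least three vertices, the cyclic predecessor and successor of a vertex differ,
  so the princess has two ways out at every vertex of the cycle and survives on it.\<close>

lemma solvable_no_cycle:
  assumes "solvable G" "vwalk xs G" "distinct xs" "3 \<le> length xs" "last xs \<rightarrow> hd xs"
  shows False
proof -
  obtain ps where ps: "winning G ps" using assms(1) by (auto simp: solvable_def)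
  have nth: "xs ! i \<rightarrow> xs ! Suc i" if "Suc i < length xs" for i
    using assms(2) that by (simp add: vwalk_iff_nth)
  have ne: "xs \<noteq> []" using assms(4) by auto
  have "\<exists>a\<in>set xs. \<exists>b\<in>set xs. a \<noteq> b \<and> v \<rightarrow> a \<and> v \<rightarrow> b" if v: "v \<in> set xs" for v
  proof -
    let ?n = "length xs"
    obtain i where i: "i < ?n" "v = xs ! i" using v by (auto simp: in_set_conv_nth)
    define a where "a = (if i = 0 then ?n - 1 else i - 1)"
    define b where "b = (if Suc i = ?n then 0 else Suc i)"
    have lt: "a < ?n" "b < ?n" "a \<noteq> b" using i(1) assms(4) by (auto simp: a_def b_def)
    have cyc: "xs ! (?n - 1) \<rightarrow> xs ! 0" using assms(5) ne by (simp add: last_conv_nth hd_conv_nth)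
    have "v \<rightarrow> xs ! b"
      using i nth[of i] cyc diff_Suc_1[of i] by (cases "Suc i = ?n") (simp_all add: b_def)
    moreover have "v \<rightarrow> xs ! a"
      using i nth[of "i - 1"] adj_sym cyc by (auto simp: a_def)
    moreover have "xs ! a \<noteq> xs ! b" using lt assms(3) by (simp add: nth_eq_iff_index_eq)
    ultimately show ?thesis using lt by (meson nth_mem)
  qed
  then show False using winning_imp_not_min_degree_2[OF ps, of "set xs"] ne by auto
qed

text \<open>Every nonempty vertex set contains a vertex with at most one neighbour in the set, since
  she could otherwise survive there. Colouring that vertex last gives an induction over finite
  sets.\<close>

lemma solvable_2_colourable:
  assumes "solvable G"
  shows "\<exists>c. proper_2_colouring G c"
proof -
  obtain ps where ps: "winning G ps" using assms by (auto simp: solvable_def)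
  have "\<exists>c :: 'a \<Rightarrow> bool. \<forall>u\<in>C. \<forall>v\<in>C. u \<rightarrow> v \<longrightarrow> c u \<noteq> c v" if "finite C" for C
    using that
  proof (induction C rule: finite_psubset_induct)
    case (psubset C)
    show ?case
    proof (cases "C = {}")
      case False
      then obtain v where v: "v \<in> C" "\<And>a b. a \<in> C \<Longrightarrow> b \<in> C \<Longrightarrow> v \<rightarrow> a \<Longrightarrow> v \<rightarrow> b \<Longrightarrow> a = b"
        using winning_imp_not_min_degree_2[OF ps, of C] by metis
      obtain c :: "'a \<Rightarrow> bool" where c: "\<And>u w. u \<in> C - {v} \<Longrightarrow> w \<in> C - {v} \<Longrightarrow> u \<rightarrow> w \<Longrightarrow> c u \<noteq> c w"
        using psubset(2)[of "C - {v}"] v(1) by (metis Diff_subset psubsetI insert_Diff insertCI Diff_iff)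
      \<comment> \<open>\<open>v\<close> receives the colour opposite to that of its only neighbour
        in \<open>C\<close>, if it has one.\<close>
      define c' where "c' = c(v := (\<forall>a\<in>C. v \<rightarrow> a \<longrightarrow> \<not> c a))"
      have *: "c' v \<noteq> c' a" if "a \<in> C" "v \<rightarrow> a" for a
        using that v(2) adj_neq[of v a] by (auto simp: c'_def)
      have "c' u \<noteq> c' w" if "u \<in> C" "w \<in> C" "u \<rightarrow> w" for u w
      proof (cases "u = v \<or> w = v")
        case True
        then show ?thesis using * that adj_sym by metis
      next
        case False
        then show ?thesis using c[of u w] that by (simp add: c'_def)
      qed
      then show ?thesis by blast
    qed simp
  qed
  then obtain c :: "'a \<Rightarrow> bool" where "\<And>u v. u \<in> verts G \<Longrightarrow> v \<in> verts G \<Longrightarrow> u \<rightarrow> v \<Longrightarrow> c u \<noteq> c v"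
    using finite_verts by metis
  then show ?thesis unfolding proper_2_colouring_def using adj_in_verts by metis
qed

end

section \<open>Branches off a longest path\<close>

locale palace = graph G for G :: "('a, 'b) pre_digraph" (structure) +
  fixes P :: "'a list"
  assumes connected: "connected G" and solvable: "solvable G"
    and longest: "longest_path G P" and card_verts: "3 \<le> card (verts G)"
begin

text \<open>Reversal of \<open>P\<close> stays within the locale. This yields the mirror image of
  one-sided bounds, and later the second search of the strategy.\<close>

lemma palace_rev: "palace G (rev P)"
  by (intro palace.intro palace_axioms.intro graph_axioms connected solvable longest_path_rev[OF longest] card_verts)

lemma vwalk_P: "vwalk P G" and distinct_P: "distinct P" and P_verts: "set P \<subseteq> verts G" and P_ne: "P \<noteq> []"
  and longest_P: "\<And>Q. vwalk Q G \<Longrightarrow> distinct Q \<Longrightarrow> length Q \<le> length P"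
proof -
  show *: "vwalk P G" "distinct P" using longest by (auto simp: longest_path_def vpath_def)
  then show P: "set P \<subseteq> verts G" "P \<noteq> []" by (auto simp: vwalk_def)
  fix Q assume "vwalk Q G" "distinct Q"
  then have "length Q - 1 \<le> length P - 1" using longest by (auto simp: longest_path_def vpath_def)
  then show "length Q \<le> length P" using P(2) by (cases P) auto
qed

lemma P_adj: "Suc i < length P \<Longrightarrow> P ! i \<rightarrow> P ! Suc i"
  using vwalk_P by (simp add: vwalk_iff_nth)

lemma P_nth_eq: "i < length P \<Longrightarrow> j < length P \<Longrightarrow> P ! i = P ! j \<longleftrightarrow> i = j"
  using distinct_P by (simp add: nth_eq_iff_index_eq)

lemma P_segment:
  assumes "i \<le> j" "j < length P"
  shows "vwalk (map ((!) P) [i..<Suc j]) G" and "distinct (map ((!) P) [i..<Suc j])"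
    and "set (map ((!) P) [i..<Suc j]) \<subseteq> set P"
proof -
  show sub: "set (map ((!) P) [i..<Suc j]) \<subseteq> set P" using assms by auto
  have "(map ((!) P) [i..<Suc j]) ! k \<rightarrow> (map ((!) P) [i..<Suc j]) ! Suc k"
    if "Suc k < length (map ((!) P) [i..<Suc j])" for k
    using that assms P_adj[of "i + k"] by (simp del: upt_Suc)
  then show "vwalk (map ((!) P) [i..<Suc j]) G"
    using sub P_verts assms by (auto simp: vwalk_iff_nth simp del: upt_Suc)
  show "distinct (map ((!) P) [i..<Suc j])"
    using assms P_nth_eq by (auto simp: distinct_map inj_on_def simp del: upt_Suc)
qed

text \<open>\<open>Q\<close> followed by the part of \<open>P\<close> from index \<open>i\<close> on
  is again a path. By maximality, \<open>Q\<close> is no longer than the \<open>i\<close> vertices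
  that it replaces.\<close>

lemma branch_length_le_left:
  assumes "vwalk Q G" "distinct Q" "set Q \<inter> set P = {}" "i < length P" "last Q \<rightarrow> P ! i"
  shows "length Q \<le> i"
proof -
  have ne: "Q \<noteq> []" "drop i P \<noteq> []" using assms(1,4) by (auto simp: vwalk_def)
  have "vwalk (drop i P) G"
    using ne vwalk_P vwalkI_append_r[of "drop i P" "take i P" G] by simp
  then have "vwalk (Q @ drop i P) G"
    using assms ne by (simp add: vwalk_append_iff hd_drop_conv_nth)
  moreover have "distinct (Q @ drop i P)"
    using assms(2,3) distinct_P set_drop_subset[of i P] by auto
  ultimately show ?thesis using longest_P[of "Q @ drop i P"] assms(4) by simp
qed

text \<open>The second bound is the first one for \<open>rev P\<close>, where index \<open>i\<close>
  becomes \<open>length P - Suc i\<close>.\<close>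

lemma branch_length_le:
  assumes "vwalk Q G" "distinct Q" "set Q \<inter> set P = {}" "i < length P" "last Q \<rightarrow> P ! i"
  shows "length Q \<le> i" "length Q + i < length P"
proof -
  show "length Q \<le> i" using assms by (rule branch_length_le_left)
  have "length Q \<le> length P - Suc i"
    by (rule palace.branch_length_le_left[OF palace_rev]) (use assms in \<open>auto simp: rev_nth\<close>)
  then show "length Q + i < length P" using assms(4) by simp
qed

lemma P_no_chord:
  assumes "i < j" "j < length P" "P ! i \<rightarrow> P ! j"
  shows "j = Suc i"
proof (rule ccontr)
  assume "j \<noteq> Suc i"
  then have "3 \<le> length (map ((!) P) [i..<Suc j])" using assms(1) by (simp del: upt_Suc)
  moreover have "last (map ((!) P) [i..<Suc j]) \<rightarrow> hd (map ((!) P) [i..<Suc j])"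
    using assms adj_sym by (simp add: last_map hd_map del: upt_Suc)
  ultimately show False
    using solvable_no_cycle[OF solvable P_segment(1,2)[of i j]] assms by simp
qed

lemma P_neighbours:
  assumes "i < length P" "j < length P" "P ! i \<rightarrow> P ! j"
  shows "j = Suc i \<or> i = Suc j"
  using assms P_no_chord[of i j] P_no_chord[of j i] adj_sym adj_neq by (metis nat_neq_iff)

text \<open>Two neighbours on \<open>P\<close> would close the segment between them to a cycle
  through \<open>v\<close>.\<close>

lemma unique_P_neighbour:
  assumes "v \<notin> set P" "i < length P" "j < length P" "v \<rightarrow> P ! i" "v \<rightarrow> P ! j"
  shows "i = j"
proof -
  have False if "i < j" "j < length P" "v \<rightarrow> P ! i" "v \<rightarrow> P ! j" for i j
  proof (rule solvable_no_cycle[OF solvable])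
    let ?S = "map ((!) P) [i..<Suc j]"
    have hd: "hd ?S = P ! i" and last: "last ?S = P ! j" and ne: "?S \<noteq> []"
      using that by (simp_all add: last_map hd_map del: upt_Suc)
    show "vwalk (v # ?S) G"
      using that P_segment(1)[of i j] hd ne adj_in_verts(1) by (intro vwalk_consI) auto
    show "distinct (v # ?S)" using that P_segment(2,3)[of i j] assms(1) by auto
    show "3 \<le> length (v # ?S)" using that by (simp del: upt_Suc)
    show "last (v # ?S) \<rightarrow> hd (v # ?S)" using last ne that(4) adj_sym by simp
  qed
  then show ?thesis using assms by (metis nat_neq_iff)
qed

text \<open>The segment between the two attachment points would close up with \<open>v\<close> and
  \<open>y\<close> to a cycle, a triangle if \<open>i = j\<close>.\<close>

lemma no_double_attachment:
  assumes "v \<notin> set P" "y \<notin> set P" "v \<rightarrow> y" "i < length P" "j < length P" "v \<rightarrow> P ! i" "y \<rightarrow> P ! j"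
  shows False
proof -
  have False if "v \<notin> set P" "y \<notin> set P" "v \<rightarrow> y" "i \<le> j" "j < length P" "v \<rightarrow> P ! i" "y \<rightarrow> P ! j" for i j v y
  proof (rule solvable_no_cycle[OF solvable])
    let ?S = "map ((!) P) [i..<Suc j]"
    have hd: "hd ?S = P ! i" and last: "last ?S = P ! j" and ne: "?S \<noteq> []"
      using that by (simp_all add: last_map hd_map del: upt_Suc)
    have "y \<noteq> v" using that(3) adj_neq by blast
    have "vwalk (v # ?S) G"
      using that P_segment(1)[of i j] hd ne adj_in_verts(1) by (intro vwalk_consI) auto
    then show "vwalk (y # v # ?S) G"
      using adj_in_verts(2)[OF that(3)] adj_sym[OF that(3)] vwalk_consI[of "v # ?S" G y] by simp
    show "distinct (y # v # ?S)" using that P_segment(2,3)[of i j] \<open>y \<noteq> v\<close> by auto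
    show "3 \<le> length (y # v # ?S)" using that by (simp del: upt_Suc)
    show "last (y # v # ?S) \<rightarrow> hd (y # v # ?S)" using last ne that(7) adj_sym by simp
  qed
  \<comment> \<open>The situation is symmetric in \<open>v\<close> and \<open>y\<close>, so
    \<open>i \<le> j\<close> may be assumed.\<close>
  from this[of v y i j] this[of y v j i] show ?thesis
    using assms adj_sym[OF assms(3)] by (cases "i \<le> j") simp_all
qed

lemma has_neighbour: "v \<in> verts G \<Longrightarrow> \<exists>u. v \<rightarrow> u"
  using connected card_verts by (rule connected_has_neighbour)

lemma end_neighbours:
  assumes "i < length P" "P ! i \<rightarrow> v" "i = 0 \<or> Suc i = length P"
  shows "v \<in> set P"
proof (rule ccontr)
  assume "v \<notin> set P"
  then show False
    using branch_length_le[of "[v]" i] assms adj_sym adj_in_verts by (auto simp: vwalk_def)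
qed

text \<open>If \<open>P\<close> had at most two vertices, each would be an end and have all its
  neighbours on \<open>P\<close>; by connectivity \<open>P\<close> would then cover the whole
  graph.\<close>

lemma length_P: "3 \<le> length P"
proof (rule ccontr)
  assume short: "\<not> 3 \<le> length P"
  have "v \<in> set P" if u: "u \<in> set P" "u \<rightarrow> v" for u v
  proof -
    obtain i where "i < length P" "u = P ! i" using u(1) by (auto simp: in_set_conv_nth)
    then show ?thesis using end_neighbours[of i v] u(2) short by fastforce
  qed
  then have "set P = verts G"
    using P_ne P_verts by (intro connected_closed_eq_verts[OF connected, of "hd P"]) auto
  then show False using card_verts card_length[of P] short by simp
qed

section \<open>Nonleaf vertices on and off the path\<close>

definition inner :: "'a list" where "inner = butlast (tl P)"

definition attached :: "'a \<Rightarrow> 'a set" where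
  "attached x = {v. x \<rightarrow> v \<and> v \<notin> set P \<and> \<not> leaf G v}"

lemma finite_attached [simp]: "finite (attached x)"
  by (rule finite_subset[OF _ finite_neighbours[of x]]) (auto simp: attached_def)

lemma length_inner: "length inner = length P - 2"
  by (simp add: inner_def)

lemma nth_inner: "i < length inner \<Longrightarrow> inner ! i = P ! Suc i"
  by (simp add: inner_def nth_butlast nth_tl)

lemma distinct_inner: "distinct inner"
  using distinct_P by (simp add: inner_def distinct_butlast distinct_tl)

lemma set_inner: "set inner = {P ! i | i. 0 < i \<and> Suc i < length P}"
proof -
  have "set inner = {P ! Suc i | i. i < length P - 2}"
    using length_inner nth_inner by (auto simp: set_conv_nth) metis+
  also have "\<dots> = {P ! i | i. 0 < i \<and> Suc i < length P}"
    by (auto intro: exI[of _ "_ - 1"] simp: Suc_lessI)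
       (metis One_nat_def Suc_diff_1 Suc_lessD diff_Suc_1 less_diff_conv numeral_2_eq_2 add_2_eq_Suc')
  finally show ?thesis .
qed

text \<open>A nonleaf \<open>v\<close> off \<open>P\<close> has a further neighbour
  \<open>y\<close>, which is also off \<open>P\<close>. So \<open>[y, v]\<close> is a branch of two
  vertices, and \<open>P\<close> must extend at least as far on both sides of
  \<open>P ! i\<close>.\<close>

lemma attached_index:
  assumes "i < length P" "v \<in> attached (P ! i)"
  shows "2 \<le> i" "i + 2 < length P"
proof -
  have v: "P ! i \<rightarrow> v" "v \<notin> set P" "\<not> leaf G v" using assms(2) by (auto simp: attached_def)
  obtain y where y: "y \<noteq> P ! i" "v \<rightarrow> y" using nonleaf_other_neighbour[OF v(3)] adj_sym[OF v(1)] by blast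
  have "y \<notin> set P"
  proof
    assume "y \<in> set P"
    then obtain j where "j < length P" "y = P ! j" by (auto simp: in_set_conv_nth)
    then show False using unique_P_neighbour[OF v(2) assms(1)] adj_sym[OF v(1)] y by blast
  qed
  moreover have "vwalk [y, v] G" using y(2) adj_sym adj_in_verts by (auto simp: vwalk_def)
  ultimately show "2 \<le> i" "i + 2 < length P"
    using branch_length_le[of "[y, v]" i] assms(1) v(2) adj_sym[OF v(1)] adj_neq[OF y(2)] by auto
qed

text \<open>If \<open>y\<close> were not a leaf, it would have another neighbour \<open>z\<close>,
  giving a branch of three vertices off \<open>P\<close>. By maximality \<open>P\<close> also has
  three vertices on each side of \<open>P ! i\<close>, which makes three long branches there,
  contrary to solvability.\<close>

lemma attached_neighbour_leaf:
  assumes i: "i < length P" "v \<in> attached (P ! i)" and y: "v \<rightarrow> y" "y \<noteq> P ! i"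
  shows "y \<notin> set P" "leaf G y"
proof -
  have v: "P ! i \<rightarrow> v" "v \<notin> set P" "\<not> leaf G v" using assms(2) by (auto simp: attached_def)
  show yP: "y \<notin> set P"
  proof
    assume "y \<in> set P"
    then obtain j where "j < length P" "y = P ! j" by (auto simp: in_set_conv_nth)
    then show False using unique_P_neighbour[OF v(2) i(1)] adj_sym[OF v(1)] y by blast
  qed
  show "leaf G y"
  proof (rule ccontr)
    assume "\<not> leaf G y"
    then obtain z where z: "z \<noteq> v" "y \<rightarrow> z" using nonleaf_other_neighbour adj_sym[OF y(1)] by blast
    have "z \<notin> set P"
    proof
      assume "z \<in> set P"
      then obtain j where "j < length P" "z = P ! j" by (auto simp: in_set_conv_nth)
      then show False using no_double_attachment[OF v(2) yP y(1) i(1)] adj_sym[OF v(1)] z by blast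
    qed
    moreover have "vwalk [z, y, v] G" using z(2) y(1) adj_sym adj_in_verts by (auto simp: vwalk_def)
    ultimately have i3: "3 \<le> i" "i + 3 < length P"
      using branch_length_le[of "[z, y, v]" i] i v(2) yP adj_sym[OF v(1)] adj_neq[OF y(1)] adj_neq[OF z(2)] z(1) by auto
    obtain ps where ps: "winning G ps" using solvable by (auto simp: solvable_def)
    let ?X = "{v, P ! (i - 1), P ! Suc i}"
    have "v \<noteq> P ! (i - 1)" "v \<noteq> P ! Suc i" using v(2) i3 by auto
    moreover have "P ! (i - 1) \<noteq> P ! Suc i" using i3 by (subst P_nth_eq) auto
    ultimately have "card ?X = 3" by simp
    moreover have "P ! i \<rightarrow> x \<and> (\<exists>b. b \<noteq> P ! i \<and> x \<rightarrow> b \<and> (\<exists>d. d \<noteq> x \<and> b \<rightarrow> d))" if x: "x \<in> ?X" for x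
    proof -
      have down: "P ! k \<rightarrow> P ! (k - 1)" if "0 < k" "k < length P" for k
        using P_adj[of "k - 1"] that adj_sym by simp
      consider "x = v" | "x = P ! (i - 1)" | "x = P ! Suc i" using x by blast
      then show ?thesis
      proof cases
        case 1
        then show ?thesis using v(1) y z by blast
      next
        case 2
        then show ?thesis
          using down[of i] down[of "i - 1"] down[of "i - 2"] i3 i(1)
          by (intro conjI exI[of _ "P ! (i - 2)"] exI[of _ "P ! (i - 3)"]) (auto simp: P_nth_eq numeral_eq_Suc)
      next
        case 3
        then show ?thesis
          using P_adj[of i] P_adj[of "Suc i"] P_adj[of "Suc (Suc i)"] i3 i(1)
          by (intro conjI exI[of _ "P ! Suc (Suc i)"] exI[of _ "P ! Suc (Suc (Suc i))"]) (auto simp: P_nth_eq)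
      qed
    qed
    ultimately show False using winning_no_long_branches[OF ps, of ?X "P ! i"] by simp
  qed
qed

text \<open>The path, its neighbours, and the leaves adjacent to any of these form a set
  \<open>?B\<close> closed under adjacency, hence all vertices. A nonleaf vertex thus lies on
  \<open>P\<close> or next to it.\<close>

lemma nonleaf_inner_or_attached:
  assumes "v \<in> nonleaves G" "v \<notin> set inner"
  shows "\<exists>x \<in> set inner. v \<in> attached x"
proof -
  let ?A = "set P \<union> {v. \<exists>x\<in>set P. x \<rightarrow> v}"
  let ?B = "?A \<union> {v. leaf G v \<and> (\<exists>x\<in>?A. x \<rightarrow> v)}"
  have "?B = verts G"
  proof (rule connected_closed_eq_verts[OF connected])
    show "hd P \<in> ?B" using P_ne by simp
    show "?B \<subseteq> verts G" using P_verts adj_in_verts by (auto simp: leaf_def)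
    fix a b assume a: "a \<in> ?B" and ab: "a \<rightarrow> b"
    consider "a \<in> set P" | x where "a \<notin> set P" "x \<in> set P" "x \<rightarrow> a" | x where "leaf G a" "x \<in> ?A" "x \<rightarrow> a"
      using a by blast
    then show "b \<in> ?B"
    proof cases
      case 1
      then show ?thesis using ab by blast
    next
      case 2
      obtain i where i: "i < length P" "x = P ! i" using 2(2) by (auto simp: in_set_conv_nth)
      show ?thesis
      proof (cases "b = x")
        case False
        then have "\<not> leaf G a" using two_neighbours_nonleaf[OF ab adj_sym[OF 2(3)]] by blast
        then have "a \<in> attached (P ! i)" using 2 i by (simp add: attached_def)
        then have "leaf G b" using attached_neighbour_leaf(2)[OF i(1) _ ab] False i(2) by blast
        then show ?thesis using 2(2,3) ab by blast
      qed (use 2 in blast)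
    next
      case 3
      then have "b = x" using leaf_unique_neighbour[OF 3(1) ab adj_sym[OF 3(3)]] by blast
      then show ?thesis using 3 by blast
    qed
  qed
  then have vA: "v \<in> ?A" using assms(1) unfolding nonleaves_def by blast
  show ?thesis
  proof (cases "v \<in> set P")
    case True
    then obtain i where i: "i < length P" "v = P ! i" by (auto simp: in_set_conv_nth)
    \<comment> \<open>The case is impossible: an end of \<open>P\<close> has no neighbour off
      \<open>P\<close> and only one on it, so it is a leaf.\<close>
    then have ends: "i = 0 \<or> Suc i = length P" using assms(2) unfolding set_inner by auto
    obtain u where u: "v \<rightarrow> u" using has_neighbour assms(1) unfolding nonleaves_def by blast
    then obtain w where w: "w \<noteq> u" "v \<rightarrow> w" using nonleaf_other_neighbour assms(1) unfolding nonleaves_def by blast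
    obtain j k where "j < length P" "u = P ! j" "k < length P" "w = P ! k"
      using end_neighbours[OF i(1) _ ends] u w(2) i(2) by (metis in_set_conv_nth)
    then show ?thesis using P_neighbours[OF i(1)] ends u w i(2) by (metis Suc_inject Zero_not_Suc less_irrefl)
  next
    case False
    then obtain x where x: "x \<in> set P" "x \<rightarrow> v" using vA by blast
    then obtain i where i: "i < length P" "x = P ! i" by (auto simp: in_set_conv_nth)
    then have v: "v \<in> attached (P ! i)" using x False assms(1) by (auto simp: attached_def nonleaves_def)
    then show ?thesis using attached_index[OF i(1) v] i unfolding set_inner by (intro bexI[of _ "P ! i"]) auto
  qed
qed

end

section \<open>Counting the vertices of the reduction\<close>

context graph
begin

lemma del_vert_adj: "u \<rightarrow>\<^bsub>del_vert v\<^esub> w \<longleftrightarrow> u \<rightarrow> w \<and> u \<noteq> v \<and> w \<noteq> v"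
  by (auto simp: arcs_ends_conv del_vert_simps)

lemma graph_del_vert: "graph (del_vert v)"
proof -
  interpret D: wf_digraph "del_vert v" by (rule wf_digraph_del_vert)
  show ?thesis
  proof unfold_locales
    show "symmetric (del_vert v)"
      unfolding symmetric_def by (rule symI) (simp add: del_vert_adj adj_sym)
    show "finite (verts (del_vert v))" "finite (arcs (del_vert v))"
      by (simp_all add: del_vert_simps)
    show "tail (del_vert v) e \<noteq> head (del_vert v) e" if "e \<in> arcs (del_vert v)" for e
      using that no_loops[of e] by (simp add: del_vert_simps)
    show "e1 = e2" if "e1 \<in> arcs (del_vert v)" "e2 \<in> arcs (del_vert v)"
      "arc_to_ends (del_vert v) e1 = arc_to_ends (del_vert v) e2" for e1 e2
      using that no_multi_arcs[of e1 e2] by (simp add: del_vert_simps arc_to_ends_def)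
  qed
qed

text \<open>The neighbour of a removable leaf keeps degree at least 2, so its deletion creates no
  new leaf.\<close>

lemma leaf_del_removable_leaf:
  assumes "removable_leaf G v"
  shows "leaf (del_vert v) x \<longleftrightarrow> leaf G x \<and> x \<noteq> v"
proof (cases "x = v")
  case False
  interpret D: graph "del_vert v" by (rule graph_del_vert)
  obtain u where u: "leaf G v" "v \<rightarrow> u" "3 \<le> card {w. u \<rightarrow> w}"
    using assms by (auto simp: removable_leaf_def out_degree_eq_card_neighbours)
  have D: "{w. x \<rightarrow>\<^bsub>del_vert v\<^esub> w} = {w. x \<rightarrow> w} - {v}"
    using False by (auto simp: del_vert_adj)
  show ?thesis
  proof (cases "x = u")
    case True
    then have "v \<in> {w. x \<rightarrow> w}" using adj_sym[OF u(2)] by simp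
    then have "card ({w. x \<rightarrow> w} - {v}) = card {w. x \<rightarrow> w} - 1" by simp
    then have "card {w. x \<rightarrow>\<^bsub>del_vert v\<^esub> w} \<noteq> 1" "card {w. x \<rightarrow> w} \<noteq> 1" using D u(3) True by simp_all
    then show ?thesis
      by (simp add: leaf_def out_degree_eq_card_neighbours D.out_degree_eq_card_neighbours)
  next
    case False': False
    have "v \<notin> {w. x \<rightarrow> w}" using leaf_unique_neighbour[OF u(1,2)] False' adj_sym by blast
    then have "{w. x \<rightarrow> w} - {v} = {w. x \<rightarrow> w}" by blast
    then show ?thesis
      using False by (simp add: leaf_def out_degree_eq_card_neighbours D.out_degree_eq_card_neighbours D verts_del_vert)
  qed
qed (simp add: leaf_def verts_del_vert)

text \<open>Each leaf hangs at exactly one nonleaf \<open>u\<close>. The degree of \<open>u\<close>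
  is at least 2, and irreducibility makes it exactly 2 as soon as a leaf hangs there. So the number
  of leaves at \<open>u\<close> is the truncated difference of 2 and the number of nonleaf
  neighbours.\<close>

lemma card_verts_irreducible:
  assumes nbr: "\<And>v. v \<in> verts G \<Longrightarrow> \<exists>u. v \<rightarrow> u"
    and leaf: "\<And>u v. leaf G u \<Longrightarrow> u \<rightarrow> v \<Longrightarrow> \<not> leaf G v"
    and irred: "\<nexists>v. removable_leaf G v"
  shows "card (verts G) = (\<Sum>u\<in>nonleaves G. 1 + (2 - card {y \<in> nonleaves G. u \<rightarrow> y}))"
proof -
  let ?N = "nonleaves G"
  define L where "L u = {y. leaf G y \<and> u \<rightarrow> y}" for u
  define K where "K u = {y \<in> ?N. u \<rightarrow> y}" for u
  have fin: "finite ?N" "finite (L u)" "finite (K u)" for u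
    by (simp_all add: nonleaves_def L_def K_def)
  have L: "L u \<subseteq> verts G" "L u \<inter> ?N = {}" "K u \<subseteq> ?N" for u
    by (auto simp: L_def K_def nonleaves_def leaf_def)
  have "v \<in> ?N \<union> (\<Union>u\<in>?N. L u)" if v: "v \<in> verts G" for v
  proof (cases "leaf G v")
    case True
    then obtain u where "v \<rightarrow> u" using nbr[OF v] by blast
    then have "u \<in> ?N" "u \<rightarrow> v" using leaf[OF True] adj_in_verts(2)[of v u] adj_sym[of v u] by (simp_all add: nonleaves_def)
    then show ?thesis using True unfolding L_def by blast
  qed (simp add: v nonleaves_def)
  moreover have "?N \<subseteq> verts G" by (auto simp: nonleaves_def)
  ultimately have V: "verts G = ?N \<union> (\<Union>u\<in>?N. L u)" using L(1) by blast
  have "card (verts G) = card ?N + card (\<Union>u\<in>?N. L u)"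
    unfolding V using L(2) fin by (intro card_Un_disjoint) blast+
  also have "card (\<Union>u\<in>?N. L u) = (\<Sum>u\<in>?N. card (L u))"
  proof (rule card_UN_disjoint)
    have "L i \<inter> L j = {}" if "i \<noteq> j" for i j
      using that leaf_unique_neighbour adj_sym unfolding L_def by blast
    then show "\<forall>i\<in>?N. \<forall>j\<in>?N. i \<noteq> j \<longrightarrow> L i \<inter> L j = {}" by blast
  qed (simp_all add: fin)
  also have "\<dots> = (\<Sum>u\<in>?N. 2 - card (K u))"
  proof (rule sum.cong[OF refl])
    fix u assume u: "u \<in> ?N"
    have "{w. u \<rightarrow> w} = L u \<union> K u"
      using adj_in_verts(2) by (auto simp: nonleaves_def L_def K_def)
    moreover have "card (L u \<union> K u) = card (L u) + card (K u)"
      using L(2,3) by (intro card_Un_disjoint fin) blast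
    ultimately have deg: "card {w. u \<rightarrow> w} = card (L u) + card (K u)" by simp
    have "{w. u \<rightarrow> w} \<noteq> {}" using nbr[of u] u by (simp add: nonleaves_def)
    then have "card {w. u \<rightarrow> w} \<noteq> 0" by simp
    moreover have "card {w. u \<rightarrow> w} \<noteq> 1" using u by (simp add: nonleaves_def leaf_def out_degree_eq_card_neighbours)
    moreover have "card {w. u \<rightarrow> w} < 3" if nz: "card (L u) \<noteq> 0"
    proof -
      have "L u \<noteq> {}" using nz by (metis card.empty)
      then obtain y where "leaf G y" "y \<rightarrow> u" unfolding L_def using adj_sym by blast
      then have "\<not> 3 \<le> card {w. u \<rightarrow> w}"
        using irred unfolding removable_leaf_def out_degree_eq_card_neighbours by blast
      then show ?thesis by simp
    qed
    ultimately show "card (L u) = 2 - card (K u)" using deg by linarith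
  qed
  finally show ?thesis unfolding sum.distrib K_def by simp
qed

text \<open>Instead of connectivity, the induction carries two local consequences of it: every
  vertex has a neighbour, and no two leaves are adjacent. Both survive a deletion and are what
  \<open>card_verts_irreducible\<close> asks of the final graph.\<close>

lemma reduction_invariants:
  assumes nbr: "\<And>v. v \<in> verts G \<Longrightarrow> \<exists>u. v \<rightarrow> u"
    and leaf: "\<And>u v. leaf G u \<Longrightarrow> u \<rightarrow> v \<Longrightarrow> \<not> leaf G v"
    and red: "reduction_step\<^sup>*\<^sup>* G H"
  shows "graph H \<and> nonleaves H = nonleaves G \<and>
    (\<forall>u\<in>nonleaves G. \<forall>v\<in>nonleaves G. u \<rightarrow>\<^bsub>H\<^esub> v \<longleftrightarrow> u \<rightarrow> v) \<and>
    (\<forall>v\<in>verts H. \<exists>u. v \<rightarrow>\<^bsub>H\<^esub> u) \<and> (\<forall>u v. leaf H u \<longrightarrow> u \<rightarrow>\<^bsub>H\<^esub> v \<longrightarrow> \<not> leaf H v)"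
  using red
proof (induction rule: rtranclp_induct)
  case base
  then show ?case using nbr leaf graph_axioms by blast
next
  case (step X Y)
  interpret X: graph X using step.IH by blast
  obtain v where v: "removable_leaf X v" "Y = X.del_vert v"
    using step.hyps(2) by (auto simp: reduction_step_def)
  note leafY = X.leaf_del_removable_leaf[OF v(1), folded v(2)]
  note adjY = X.del_vert_adj[where v = v, folded v(2)]
  have vleaf: "leaf X v" using v(1) by (simp add: removable_leaf_def)
  have N: "nonleaves Y = nonleaves X"
    using vleaf leafY by (auto simp: nonleaves_def v(2) X.verts_del_vert)
  have vN: "v \<notin> nonleaves X" using vleaf by (simp add: nonleaves_def)
  \<comment> \<open>If the neighbour found for \<open>u\<close> is the deleted leaf
    \<open>v\<close>, then \<open>u\<close> is no leaf and has another one.\<close>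
  have nonleaf_nbr: "\<exists>w. u \<rightarrow>\<^bsub>X\<^esub> w \<and> w \<noteq> v" if "u \<in> verts X" "u \<noteq> v" for u
  proof -
    obtain w where w: "u \<rightarrow>\<^bsub>X\<^esub> w" using step.IH \<open>u \<in> verts X\<close> by blast
    show ?thesis
    proof (cases "w = v")
      case True
      then have "\<not> leaf X u" using X.adj_sym[OF w] step.IH vleaf by blast
      then show ?thesis using X.nonleaf_other_neighbour[OF _ w] True by blast
    qed (use w in blast)
  qed
  have "graph Y" using X.graph_del_vert v(2) by simp
  moreover have "nonleaves Y = nonleaves G" using N step.IH by simp
  moreover have "\<forall>a\<in>nonleaves G. \<forall>b\<in>nonleaves G. a \<rightarrow>\<^bsub>Y\<^esub> b \<longleftrightarrow> a \<rightarrow> b"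
    using step.IH vN adjY by metis
  moreover have "\<exists>w. u \<rightarrow>\<^bsub>Y\<^esub> w" if "u \<in> verts Y" for u
    using nonleaf_nbr[of u] that unfolding adjY by (auto simp: v(2) X.verts_del_vert)
  moreover have "\<not> leaf Y b" if "leaf Y a" "a \<rightarrow>\<^bsub>Y\<^esub> b" for a b
  proof -
    have "leaf X a" "a \<rightarrow>\<^bsub>X\<^esub> b" using that unfolding leafY adjY by simp_all
    then have "\<not> leaf X b" using step.IH by simp
    then show ?thesis unfolding leafY by simp
  qed
  ultimately show ?case by blast
qed

lemma reduction_verts_subset: "reduction_step\<^sup>*\<^sup>* G H \<Longrightarrow> verts H \<subseteq> verts G"
proof (induction rule: rtranclp_induct)
  case (step X Y)
  then obtain v where "Y = pre_digraph.del_vert X v" by (auto simp: reduction_step_def)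
  then show ?case using step.IH by (auto simp: pre_digraph.verts_del_vert)
qed simp

lemma card_reduction:
  assumes "connected G" and red: "is_reduction G H" and card: "3 \<le> card (verts H)"
  shows "card (verts H) = (\<Sum>u\<in>nonleaves G. 1 + (2 - card {y \<in> nonleaves G. u \<rightarrow> y}))"
proof -
  have steps: "reduction_step\<^sup>*\<^sup>* G H" and irred: "\<nexists>v. removable_leaf H v"
    using red by (simp_all add: is_reduction_def)
  have big: "3 \<le> card (verts G)"
    using card card_mono[OF finite_verts reduction_verts_subset[OF steps]] by simp
  have inv: "graph H" "nonleaves H = nonleaves G"
    "\<And>u v. u \<in> nonleaves G \<Longrightarrow> v \<in> nonleaves G \<Longrightarrow> u \<rightarrow>\<^bsub>H\<^esub> v \<longleftrightarrow> u \<rightarrow> v"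
    "\<And>v. v \<in> verts H \<Longrightarrow> \<exists>u. v \<rightarrow>\<^bsub>H\<^esub> u" "\<And>u v. leaf H u \<Longrightarrow> u \<rightarrow>\<^bsub>H\<^esub> v \<Longrightarrow> \<not> leaf H v"
    using reduction_invariants[OF connected_has_neighbour[OF assms(1) big]
        connected_leaf_neighbour[OF assms(1) big] steps] by simp_all
  have "card (verts H) = (\<Sum>u\<in>nonleaves G. 1 + (2 - card {y \<in> nonleaves G. u \<rightarrow>\<^bsub>H\<^esub> y}))"
    using graph.card_verts_irreducible[OF inv(1,4,5) irred] by (simp add: inv(2))
  also have "\<dots> = (\<Sum>u\<in>nonleaves G. 1 + (2 - card {y \<in> nonleaves G. u \<rightarrow> y}))"
  proof (rule sum.cong[OF refl])
    fix u assume "u \<in> nonleaves G"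
    then have "{y \<in> nonleaves G. u \<rightarrow>\<^bsub>H\<^esub> y} = {y \<in> nonleaves G. u \<rightarrow> y}" using inv(3) by blast
    then show "1 + (2 - card {y \<in> nonleaves G. u \<rightarrow>\<^bsub>H\<^esub> y}) = 1 + (2 - card {y \<in> nonleaves G. u \<rightarrow> y})" by simp
  qed
  finally show ?thesis .
qed

end

section \<open>The linear search\<close>

text \<open>Since the prince returns to \<open>x\<close> after each side visit, a detour begins and
  ends at \<open>x\<close>, and the detours at consecutive path vertices join to a walk.\<close>

definition detour :: "('a \<Rightarrow> 'a list) \<Rightarrow> 'a \<Rightarrow> 'a list" where
  "detour att x = x # concat (map (\<lambda>v. [v, x]) (att x))"

definition sweep :: "('a \<Rightarrow> 'a list) \<Rightarrow> 'a list \<Rightarrow> 'a list" where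
  "sweep att xs = concat (map (detour att) xs)"

lemma set_detour: "set (detour att x) = insert x (set (att x))"
  by (auto simp: detour_def)

lemma set_sweep: "set (sweep att xs) = (\<Union>x\<in>set xs. insert x (set (att x)))"
  by (simp add: sweep_def set_detour)

lemma sweep_Cons: "sweep att (x # xs) = detour att x @ sweep att xs"
  by (simp add: sweep_def)

lemma length_sweep: "length (sweep att xs) = (\<Sum>x\<leftarrow>xs. 1 + 2 * length (att x))"
proof -
  have "length (concat (map (\<lambda>v. [v, x]) vs)) = 2 * length vs" for x :: 'a and vs
    by (induction vs) auto
  then show ?thesis by (induction xs) (simp_all add: sweep_def detour_def)
qed

lemma last_detour: "last (detour att x) = x"
  by (cases "att x" rule: rev_cases) (simp_all add: detour_def)

lemma detour_ne [simp]: "detour att x \<noteq> []"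
  by (simp add: detour_def)

lemma sweep_eq_Nil [simp]: "sweep att xs = [] \<longleftrightarrow> xs = []"
  by (cases xs) (simp_all add: sweep_def)

lemma hd_sweep: "xs \<noteq> [] \<Longrightarrow> hd (sweep att xs) = hd xs"
  by (cases xs) (simp_all add: sweep_def detour_def)

lemma last_sweep: "xs \<noteq> [] \<Longrightarrow> last (sweep att xs) = last xs"
proof (induction xs)
  case (Cons x xs)
  then show ?case by (cases "xs = []") (auto simp: sweep_Cons last_detour sweep_def)
qed simp

lemma (in graph) vwalk_detour:
  assumes "x \<in> verts G" "\<And>v. v \<in> set (att x) \<Longrightarrow> x \<rightarrow> v"
  shows "vwalk (detour att x) G"
proof -
  have "vwalk (x # concat (map (\<lambda>v. [v, x]) vs)) G" if "\<And>v. v \<in> set vs \<Longrightarrow> x \<rightarrow> v" for vs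
    using that
  proof (induction vs)
    case Nil
    then show ?case using assms(1) by (simp add: vwalk_def)
  next
    case (Cons v vs)
    have v: "x \<rightarrow> v" using Cons.prems by simp
    have "vwalk (x # concat (map (\<lambda>v. [v, x]) vs)) G" using Cons by simp
    then show ?case using v adj_sym[OF v] adj_in_verts[OF v] by (simp add: vwalk_def)
  qed
  then show ?thesis unfolding detour_def using assms(2) by blast
qed

lemma (in graph) vwalk_sweep:
  assumes "vwalk xs G" "\<And>x v. v \<in> set (att x) \<Longrightarrow> x \<rightarrow> v"
  shows "vwalk (sweep att xs) G"
  using assms(1)
proof (induction xs rule: vwalk_induct)
  case (Base u)
  then show ?case using vwalk_detour[of u att] assms(2) by (simp add: sweep_def)
next
  case (Cons u v es)
  have "vwalk (detour att u) G" using vwalk_detour[of u att] assms(2) adj_in_verts[OF Cons.hyps(1)] by blast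
  then show ?case
    using Cons by (simp add: sweep_Cons[of att u] vwalk_append_iff last_detour hd_sweep)
qed

text \<open>\<open>R\<close> has to relate distinct side vertices only, because each is visited
  once; so \<open>R\<close> may forbid the repetition of such a vertex.\<close>

lemma sorted_wrt_detour:
  assumes "distinct (att x)" "R x x"
    and "\<And>v. v \<in> set (att x) \<Longrightarrow> R x v \<and> R v x"
    and "\<And>v w. v \<in> set (att x) \<Longrightarrow> w \<in> set (att x) \<Longrightarrow> v \<noteq> w \<Longrightarrow> R v w"
  shows "sorted_wrt R (detour att x)"
proof -
  have "sorted_wrt R (concat (map (\<lambda>v. [v, x]) vs))" if "set vs \<subseteq> set (att x)" "distinct vs" for vs
    using that by (induction vs) (use assms in auto)
  from this[of "att x"] show ?thesis using assms by (auto simp: detour_def)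
qed

lemma sorted_wrt_sweep:
  assumes "\<And>x. x \<in> set xs \<Longrightarrow> sorted_wrt R (detour att x)"
    and "sorted_wrt (\<lambda>x y. \<forall>a\<in>insert x (set (att x)). \<forall>b\<in>insert y (set (att y)). R a b) xs"
  shows "sorted_wrt R (sweep att xs)"
  using assms
proof (induction xs)
  case (Cons x xs)
  then show ?case by (simp add: sweep_Cons sorted_wrt_append set_detour set_sweep)
qed (simp add: sweep_def)

text \<open>Locates a moment of the sweep: the detours at \<open>xs1\<close> are complete, and the
  one at \<open>q\<close> has been carried out up to \<open>us\<close>.\<close>

lemma sweep_eq_append_Cons:
  assumes "sweep att xs = ys @ z # zs"
  shows "\<exists>xs1 q xs2 us vs. xs = xs1 @ q # xs2 \<and> detour att q = us @ z # vs \<and> ys = sweep att xs1 @ us"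
  using assms
proof (induction xs arbitrary: ys)
  case (Cons x xs)
  show ?case
  proof (cases "length ys < length (detour att x)")
    case True
    have "detour att x = take (length (detour att x)) (ys @ z # zs)"
      unfolding Cons.prems[symmetric] by (simp add: sweep_Cons)
    also have "\<dots> = ys @ z # take (length (detour att x) - Suc (length ys)) zs"
      using True by (simp add: take_Cons')
    finally have "detour att x = ys @ z # take (length (detour att x) - Suc (length ys)) zs" .
    then show ?thesis by (intro exI[of _ "[]"]) (auto simp: sweep_def)
  next
    case False
    define ys' where "ys' = drop (length (detour att x)) ys"
    have "ys = detour att x @ ys'"
      using arg_cong[OF Cons.prems, of "take (length (detour att x))"] False
        append_take_drop_id[of "length (detour att x)" ys]
      by (simp add: sweep_Cons ys'_def)
    then have "sweep att xs = ys' @ z # zs" using Cons.prems by (simp add: sweep_Cons)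
    from Cons.IH[OF this] obtain xs1 q xs2 us vs where
      "xs = xs1 @ q # xs2" "detour att q = us @ z # vs" "ys' = sweep att xs1 @ us" by blast
    then show ?thesis
      using \<open>ys = _\<close> by (intro exI[of _ "x # xs1"]) (auto simp: sweep_Cons)
  qed
qed (simp add: sweep_def)

text \<open>
  By \<open>progress\<close>, whenever the prince could reoccupy a visited nonleaf vertex but does not, all of its nonleaf
  neighbours have been visited too, so a princess of his colour can never enter the visited region.
\<close>

lemma (in graph) search_meets_walk:
  assumes c: "proper_2_colouring G c"
    and s: "vwalk s G" "\<And>v. v \<in> nonleaves G \<Longrightarrow> v \<in> set s"
    and progress: "\<And>j x y. j < length s \<Longrightarrow> x \<in> set (take j s) \<Longrightarrow> s ! j \<noteq> x \<Longrightarrow> c (s ! j) = c x \<Longrightarrow>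
      \<not> leaf G x \<Longrightarrow> x \<rightarrow> y \<Longrightarrow> \<not> leaf G y \<Longrightarrow> y \<in> set (take j s)"
    and nbr: "\<And>v. v \<in> verts G \<Longrightarrow> \<exists>u. v \<rightarrow> u"
    and leaf: "\<And>u v. leaf G u \<Longrightarrow> u \<rightarrow> v \<Longrightarrow> \<not> leaf G v"
    and w: "vwalk ws G" "length ws = length s" "c (hd ws) = c (hd s)"
  shows "\<exists>i < length s. ws ! i = s ! i"
proof (rule ccontr)
  assume "\<not> ?thesis"
  then have miss: "ws ! i \<noteq> s ! i" if "i < length s" for i using that by blast
  have c: "c u \<noteq> c v" if "u \<rightarrow> v" for u v using c that by (auto simp: proper_2_colouring_def)
  have ne: "s \<noteq> []" "ws \<noteq> []" using s(1) w(1) by (simp_all add: vwalk_def)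
  have ws: "ws ! i \<rightarrow> ws ! Suc i" and ss: "s ! i \<rightarrow> s ! Suc i" if "Suc i < length s" for i
    using that s(1) w by (simp_all add: vwalk_iff_nth)
  have same: "c (ws ! i) = c (s ! i)" if "i < length s" for i
    using that
  proof (induction i)
    case 0
    then show ?case using w(3) ne by (simp add: hd_conv_nth)
  next
    case (Suc i)
    then show ?case using c[OF ws[OF Suc.prems]] c[OF ss[OF Suc.prems]] by auto
  qed
  \<comment> \<open>On a nonleaf vertex she is outside everything visited so far, day
    \<open>j\<close> included. At a leaf, the neighbour must be unvisited before day
    \<open>j\<close>; on day \<open>j\<close> itself the prince has the colour of the leaf, so he is
    not at that neighbour either.\<close>
  have inv: "(\<not> leaf G (ws ! j) \<longrightarrow> ws ! j \<notin> set (take (Suc j) s)) \<and>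
      (leaf G (ws ! j) \<longrightarrow> (\<forall>u. ws ! j \<rightarrow> u \<longrightarrow> u \<notin> set (take j s)))" if "j < length s" for j
    using that
  proof (induction j)
    case 0
    then show ?case using miss[of 0] ne by (cases s) auto
  next
    case (Suc j)
    then have j: "j < length s" by simp
    note IH = Suc.IH[OF j]
    have step: "ws ! Suc j \<rightarrow> ws ! j" using adj_sym[OF ws[OF Suc.prems]] .
    have take: "set (take (Suc i) s) = insert (s ! i) (set (take i s))" if "i < length s" for i
      using that by (simp add: take_Suc_conv_app_nth)
    show ?case
    proof (cases "leaf G (ws ! Suc j)")
      case True
      then have "u = ws ! j" if "ws ! Suc j \<rightarrow> u" for u
        using leaf_unique_neighbour that step by blast
      then show ?thesis using True IH leaf[OF True step] by blast
    next
      case False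
      have "ws ! Suc j \<notin> set (take (Suc j) s)"
      proof
        assume visited: "ws ! Suc j \<in> set (take (Suc j) s)"
        show False
        proof (cases "leaf G (ws ! j)")
          case True
          then have "ws ! Suc j \<notin> set (take j s)" using IH adj_sym[OF step] by blast
          then have "ws ! Suc j = s ! j" using visited take[OF j] by blast
          then show False using same[OF j] c[OF step] by simp
        next
          case nl: False
          \<comment> \<open>The prince has her colour and could be at the visited vertex
            \<open>ws ! Suc j\<close>, but is elsewhere; by \<open>progress\<close> the vertex she
            comes from had been visited as well.\<close>
          have "ws ! j \<in> set (take (Suc j) s)"
            using progress[OF Suc.prems visited _ _ False step nl] miss[OF Suc.prems] same[OF Suc.prems] by metis
          then show False using IH nl by blast
        qed
      qed
      then show ?thesis using False take[OF Suc.prems] miss[OF Suc.prems] by auto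
    qed
  qed
  \<comment> \<open>After the last day \<open>n\<close> all nonleaf vertices have been visited,
    which leaves no place allowed by \<open>inv\<close>.\<close>
  define n where "n = length s - 1"
  have n: "n < length s" "Suc n = length s" using ne by (simp_all add: n_def)
  have wn: "ws ! n \<in> verts G" using w(1,2) n(1) nth_mem[of n ws] by (auto simp: vwalk_def)
  show False
  proof (cases "leaf G (ws ! n)")
    case False
    then show False using inv[OF n(1)] n(2) s(2) wn by (simp add: nonleaves_def)
  next
    case True
    obtain u where u: "ws ! n \<rightarrow> u" using nbr[OF wn] by blast
    then have "u \<in> set s" using s(2) leaf[OF True u] adj_in_verts(2)[OF u] by (simp add: nonleaves_def)
    moreover have "u \<notin> set (take n s)" using inv[OF n(1)] True u by blast
    moreover have "set s = insert (s ! n) (set (take n s))"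
      using arg_cong[OF take_Suc_conv_app_nth[OF n(1)], of set] n(2) by simp
    ultimately have "u = s ! n" by blast
    then show False using same[OF n(1)] c[OF u] by simp
  qed
qed

section \<open>Counting nonleaf vertices along the path\<close>

context palace
begin

lemma inner_ne: "inner \<noteq> []"
  using length_P length_inner by auto

lemma vwalk_inner: "vwalk inner G"
  using inner_ne P_verts set_inner length_inner P_adj nth_inner
  unfolding vwalk_iff_nth by auto

lemma set_inner_subset: "set inner \<subseteq> set P"
  unfolding set_inner by auto

lemma inner_nonleaf: "x \<in> set inner \<Longrightarrow> x \<in> nonleaves G"
proof -
  assume "x \<in> set inner"
  then obtain i where i: "x = P ! i" "0 < i" "Suc i < length P" unfolding set_inner by blast
  have "P ! i \<rightarrow> P ! Suc i" "P ! i \<rightarrow> P ! (i - 1)"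
    using P_adj[of i] adj_sym[OF P_adj[of "i - 1"]] i by simp_all
  moreover have "P ! Suc i \<noteq> P ! (i - 1)" using i by (subst P_nth_eq) auto
  ultimately show ?thesis using two_neighbours_nonleaf i adj_in_verts(1) unfolding nonleaves_def by blast
qed

lemma attached_unique:
  assumes "x \<in> set P" "y \<in> set P" "v \<in> attached x" "v \<in> attached y"
  shows "x = y"
proof -
  obtain i j where "i < length P" "x = P ! i" "j < length P" "y = P ! j"
    using assms(1,2) by (metis in_set_conv_nth)
  then show ?thesis
    using assms(3,4) unique_P_neighbour[of v i j] adj_sym unfolding attached_def by blast
qed

lemma attached_nonleaf: "v \<in> attached x \<Longrightarrow> v \<in> nonleaves G"
  using adj_in_verts(2) by (auto simp: attached_def nonleaves_def)

lemma sum_nonleaves: "(\<Sum>u\<in>nonleaves G. f u) = (\<Sum>x\<in>set inner. f x + (\<Sum>v\<in>attached x. f v))" for f :: "'a \<Rightarrow> nat"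
proof -
  have "nonleaves G = set inner \<union> (\<Union>x\<in>set inner. attached x)"
    using nonleaf_inner_or_attached inner_nonleaf attached_nonleaf by blast
  moreover have "set inner \<inter> (\<Union>x\<in>set inner. attached x) = {}"
    using set_inner_subset by (auto simp: attached_def)
  ultimately have "(\<Sum>u\<in>nonleaves G. f u) = (\<Sum>u\<in>set inner. f u) + (\<Sum>u\<in>(\<Union>x\<in>set inner. attached x). f u)"
    by (simp add: sum.union_disjoint)
  also have "(\<Sum>u\<in>(\<Union>x\<in>set inner. attached x). f u) = (\<Sum>x\<in>set inner. \<Sum>u\<in>attached x. f u)"
  proof (rule sum.UNION_disjoint)
    show "\<forall>i\<in>set inner. \<forall>j\<in>set inner. i \<noteq> j \<longrightarrow> attached i \<inter> attached j = {}"
      using attached_unique set_inner_subset by blast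
  qed simp_all
  finally show ?thesis by (simp add: sum.distrib)
qed

lemma attached_nonleaf_neighbours:
  assumes "x \<in> set inner" "v \<in> attached x"
  shows "{y \<in> nonleaves G. v \<rightarrow> y} = {x}"
proof -
  obtain i where i: "i < length P" "x = P ! i" using assms(1) unfolding set_inner by (auto dest: Suc_lessD)
  have "y = x" if "y \<in> nonleaves G" "v \<rightarrow> y" for y
    using attached_neighbour_leaf(2)[OF i(1), of v y] assms(2) that i(2) unfolding nonleaves_def by blast
  moreover have "v \<rightarrow> x" using assms(2) adj_sym unfolding attached_def by blast
  ultimately show ?thesis using inner_nonleaf[OF assms(1)] by blast
qed

lemma nonleaf_on_P_inner: "v \<in> nonleaves G \<Longrightarrow> v \<in> set P \<Longrightarrow> v \<in> set inner"
  using nonleaf_inner_or_attached unfolding attached_def by blast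

text \<open>The neighbours of \<open>P ! i\<close> on \<open>P\<close> are nonleaves except beyond
  the first and the last inner vertex. At these two nothing is attached, so each lacks exactly one
  nonleaf neighbour of two; for a path of three vertices they coincide and the deficit is 2.\<close>

lemma inner_nonleaf_neighbours:
  assumes i: "0 < i" "Suc i < length P"
  shows "2 - card {y \<in> nonleaves G. P ! i \<rightarrow> y} = (if i = 1 then 1 else 0) + (if i + 2 = length P then 1 else 0)"
proof -
  define A where "A = (if i = 1 then {} else {P ! (i - 1)})"
  define B where "B = (if i + 2 = length P then {} else {P ! Suc i})"
  have adj: "P ! i \<rightarrow> P ! Suc i" "P ! i \<rightarrow> P ! (i - 1)"
    using P_adj[of i] adj_sym[OF P_adj[of "i - 1"]] i by simp_all
  have AB: "A \<inter> B = {}" using i by (auto simp: A_def B_def P_nth_eq)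
  have "{y \<in> nonleaves G. P ! i \<rightarrow> y} = (A \<union> B) \<union> attached (P ! i)"
  proof (intro equalityI subsetI)
    fix y assume "y \<in> {y \<in> nonleaves G. P ! i \<rightarrow> y}"
    then have y: "y \<in> nonleaves G" "P ! i \<rightarrow> y" by auto
    show "y \<in> (A \<union> B) \<union> attached (P ! i)"
    proof (cases "y \<in> set P")
      case True
      obtain j where j: "y = P ! j" "0 < j" "Suc j < length P"
        using nonleaf_on_P_inner[OF y(1) True] unfolding set_inner by blast
      then have "j = Suc i \<or> i = Suc j" using P_neighbours[of i j] y(2) i by simp
      then show ?thesis using j by (auto simp: A_def B_def)
    qed (use y in \<open>simp add: attached_def nonleaves_def\<close>)
  next
    fix y assume y: "y \<in> (A \<union> B) \<union> attached (P ! i)"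
    have "P ! (i - 1) \<in> set inner" if "i \<noteq> 1" unfolding set_inner using that i by (intro CollectI exI[of _ "i - 1"]) auto
    moreover have "P ! Suc i \<in> set inner" if "i + 2 \<noteq> length P" unfolding set_inner using that i by (intro CollectI exI[of _ "Suc i"]) auto
    ultimately have "y \<in> nonleaves G" using y inner_nonleaf attached_nonleaf by (auto simp: A_def B_def split: if_splits)
    moreover have "P ! i \<rightarrow> y" using y adj by (auto simp: A_def B_def attached_def split: if_splits)
    ultimately show "y \<in> {y \<in> nonleaves G. P ! i \<rightarrow> y}" by simp
  qed
  moreover have "(A \<union> B) \<inter> attached (P ! i) = {}"
    using i by (auto simp: A_def B_def attached_def)
  moreover have fin: "finite A" "finite B" by (simp_all add: A_def B_def)
  ultimately have card: "card {y \<in> nonleaves G. P ! i \<rightarrow> y} = card A + card B + card (attached (P ! i))"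
    using AB by (simp add: card_Un_disjoint)
  have "attached (P ! i) = {}" if "i = 1 \<or> i + 2 = length P"
    using attached_index[of i] that i by fastforce
  then show "2 - card {y \<in> nonleaves G. P ! i \<rightarrow> y} = (if i = 1 then 1 else 0) + (if i + 2 = length P then 1 else 0)"
    unfolding card by (auto simp: A_def B_def)
qed

section \<open>The search: its length, optimality and order of visits\<close>

definition attached_list :: "'a \<Rightarrow> 'a list" where
  "attached_list x = (SOME vs. set vs = attached x \<and> distinct vs)"

lemma set_attached_list [simp]: "set (attached_list x) = attached x"
  and distinct_attached_list [simp]: "distinct (attached_list x)"
proof -
  have "set (attached_list x) = attached x \<and> distinct (attached_list x)"
    unfolding attached_list_def by (rule someI_ex) (use finite_distinct_list[OF finite_attached] in blast)
  then show "set (attached_list x) = attached x" "distinct (attached_list x)" by simp_all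
qed

definition search :: "'a list" where "search = sweep attached_list inner"

lemma length_search: "length search = (\<Sum>x\<in>set inner. 1 + 2 * card (attached x))"
proof -
  have "length (attached_list x) = card (attached x)" for x
    using distinct_card[OF distinct_attached_list, of x] by simp
  then show ?thesis
    by (simp add: search_def length_sweep sum_list_distinct_conv_sum_set distinct_inner)
qed

lemma set_search: "set search = nonleaves G"
proof -
  have "nonleaves G = set inner \<union> (\<Union>x\<in>set inner. attached x)"
    using nonleaf_inner_or_attached inner_nonleaf attached_nonleaf by blast
  then show ?thesis unfolding search_def set_sweep by auto
qed

lemma hd_search: "hd search = P ! 1" and last_search: "last search = P ! (length P - 2)"
proof -
  have "hd search = hd inner" "last search = last inner"
    using inner_ne by (simp_all add: search_def hd_sweep last_sweep)
  then have "hd search = inner ! 0" "last search = inner ! (length inner - 1)"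
    using inner_ne by (simp_all add: hd_conv_nth last_conv_nth)
  moreover have "inner ! 0 = P ! 1" using nth_inner[of 0] inner_ne by simp
  moreover have "inner ! (length inner - 1) = P ! (length P - 2)"
  proof -
    have "length inner - 1 < length inner" "Suc (length inner - 1) = length P - 2"
      using length_inner length_P by auto
    then show ?thesis using nth_inner[of "length inner - 1"] by simp
  qed
  ultimately show "hd search = P ! 1" "last search = P ! (length P - 2)" by simp_all
qed

lemma vwalk_search: "vwalk search G"
  unfolding search_def by (rule vwalk_sweep[OF vwalk_inner]) (simp add: attached_def)

text \<open>An inner vertex contributes 1 plus its deficit, and an attached vertex contributes 2,
  having a single nonleaf neighbour; a detour step costs 2 days as well. The deficits at the two
  extremes of \<open>inner\<close> add up to the remaining 2.\<close>

lemma card_reduction_eq: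
  "(\<Sum>u\<in>nonleaves G. 1 + (2 - card {y \<in> nonleaves G. u \<rightarrow> y})) = length search + 2"
proof -
  let ?k = "\<lambda>u. card {y \<in> nonleaves G. u \<rightarrow> y}"
  have bij: "bij_betw ((!) P) {1..length P - 2} (set inner)"
    unfolding bij_betw_def
  proof
    show "inj_on ((!) P) {1..length P - 2}"
      using P_nth_eq length_P by (intro inj_onI) auto
    show "(!) P ` {1..length P - 2} = set inner"
    proof -
      have "{1..length P - 2} = {i. 0 < i \<and> Suc i < length P}" using length_P by auto
      then show ?thesis unfolding set_inner by blast
    qed
  qed
  have "(\<Sum>x\<in>set inner. 2 - ?k x) = (\<Sum>i\<in>{1..length P - 2}. 2 - ?k (P ! i))"
    by (rule sum.reindex_bij_betw[OF bij, symmetric])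
  also have "\<dots> = (\<Sum>i\<in>{1..length P - 2}. (if i = 1 then 1 else 0) + (if i = length P - 2 then 1 else 0))"
  proof (rule sum.cong[OF refl])
    fix i assume i: "i \<in> {1..length P - 2}"
    then have "i + 2 = length P \<longleftrightarrow> i = length P - 2" "0 < i" "Suc i < length P" using length_P by auto
    then show "2 - ?k (P ! i) = (if i = 1 then 1 else 0) + (if i = length P - 2 then 1 else 0)"
      using inner_nonleaf_neighbours[of i] by simp
  qed
  also have "\<dots> = 2" using length_P by (simp add: sum.distrib)
  finally have ends: "(\<Sum>x\<in>set inner. 2 - ?k x) = 2" .
  have "(\<Sum>u\<in>nonleaves G. 1 + (2 - ?k u)) = (\<Sum>x\<in>set inner. 1 + (2 - ?k x) + (\<Sum>v\<in>attached x. 1 + (2 - ?k v)))"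
    by (rule sum_nonleaves)
  also have "\<dots> = (\<Sum>x\<in>set inner. (1 + 2 * card (attached x)) + (2 - ?k x))"
  proof (rule sum.cong[OF refl])
    fix x assume x: "x \<in> set inner"
    have "(\<Sum>v\<in>attached x. 1 + (2 - ?k v)) = (\<Sum>v\<in>attached x. 2)"
      by (rule sum.cong[OF refl]) (simp add: attached_nonleaf_neighbours[OF x])
    then show "1 + (2 - ?k x) + (\<Sum>v\<in>attached x. 1 + (2 - ?k v)) = (1 + 2 * card (attached x)) + (2 - ?k x)"
      by simp
  qed
  also have "\<dots> = length search + 2" unfolding sum.distrib[of "\<lambda>x. 1 + 2 * card (attached x)"] ends length_search ..
  finally show ?thesis .
qed

text \<open>For each parity an attached vertex needs one visit and an inner vertex \<open>x\<close>
  needs \<open>1 + card (attached x)\<close>. These are the numbers of visits paid by one search, so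
  both parities together cost two searches.\<close>

lemma winning_length_ge:
  assumes ps: "winning G ps"
  shows "2 * length search \<le> length ps"
proof -
  have pos: "1 \<le> card (visits ps b u)" if u: "u \<in> nonleaves G" and b: "b < 2" for u b
  proof -
    obtain x where "u \<rightarrow> x" using has_neighbour u unfolding nonleaves_def by blast
    moreover obtain y where "u \<rightarrow> y" "y \<noteq> x"
      using nonleaf_other_neighbour[OF _ calculation] u unfolding nonleaves_def by blast
    ultimately have "visits ps b u \<noteq> {}" using winning_visits_nonempty[OF ps b] by metis
    moreover have "finite (visits ps b u)" by (simp add: visits_def)
    ultimately show ?thesis by (simp add: Suc_le_eq card_gt_0_iff)
  qed
  have many: "1 + card (attached x) \<le> card (visits ps b x)" if x: "x \<in> set inner" and b: "b < 2" for x b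
  proof (cases "attached x = {}")
    case True
    then show ?thesis using pos[OF inner_nonleaf[OF x] b] by simp
  next
    case False
    obtain i where i: "x = P ! i" "0 < i" "Suc i < length P" using x unfolding set_inner by blast
    have i2: "2 \<le> i" "i + 2 < length P" using attached_index[of i] False i by auto
    \<comment> \<open>Something is attached at \<open>x\<close>, so both neighbours of
      \<open>x\<close> on \<open>P\<close> are inner. All of \<open>?X\<close> then consists of
      nonleaves, which open branches of length 2.\<close>
    let ?X = "insert (P ! (i - 1)) (insert (P ! Suc i) (attached x))"
    have "P ! (i - 1) \<noteq> P ! Suc i" using i2 by (subst P_nth_eq) auto
    then have "P ! (i - 1) \<notin> insert (P ! Suc i) (attached x)" "P ! Suc i \<notin> attached x"
      using i2 by (auto simp: attached_def)
    then have "card ?X = 2 + card (attached x)" by simp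
    moreover have "card ?X \<le> Suc (card (visits ps b x))"
    proof (rule winning_card_visits[OF ps b])
      fix y assume y: "y \<in> ?X"
      have "P ! (i - 1) \<in> set inner"
        unfolding set_inner using i2 by (intro CollectI exI[of _ "i - 1"]) auto
      moreover have "P ! Suc i \<in> set inner"
        unfolding set_inner using i2 by (intro CollectI exI[of _ "Suc i"]) auto
      ultimately have "\<not> leaf G y" using y inner_nonleaf by (auto simp: attached_def nonleaves_def)
      moreover have "x \<rightarrow> y"
        using y i P_adj[of i] adj_sym[OF P_adj[of "i - 1"]] by (auto simp: attached_def)
      ultimately show "x \<rightarrow> y \<and> (\<exists>z. z \<noteq> x \<and> y \<rightarrow> z)"
        using nonleaf_other_neighbour adj_sym by blast
    qed
    ultimately show ?thesis by simp
  qed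
  let ?v = "\<lambda>u. card (visits ps 0 u) + card (visits ps 1 u)"
  have "2 * length search = (\<Sum>x\<in>set inner. 2 * (1 + card (attached x)) + (\<Sum>v\<in>attached x. 2))"
    unfolding length_search sum_distrib_left by (rule sum.cong) simp_all
  also have "\<dots> \<le> (\<Sum>x\<in>set inner. ?v x + (\<Sum>v\<in>attached x. ?v v))"
  proof (intro sum_mono add_mono)
    fix x assume x: "x \<in> set inner"
    show "2 * (1 + card (attached x)) \<le> ?v x" using many[OF x, of 0] many[OF x, of 1] by simp
    show "2 \<le> ?v v" if "v \<in> attached x" for v
      using pos[OF attached_nonleaf[OF that], of 0] pos[OF attached_nonleaf[OF that], of 1] by simp
  qed
  also have "\<dots> = (\<Sum>u\<in>nonleaves G. ?v u)" by (rule sum_nonleaves[symmetric])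
  also have "\<dots> \<le> length ps" by (rule sum_visits_le) (simp add: nonleaves_def)
  finally show ?thesis .
qed

text \<open>Two conditions of a linear search, no repetition off \<open>P\<close> and no step
  backwards along \<open>P\<close>, become one relation between earlier and later entries, which can
  be checked detour by detour.\<close>

lemma search_order:
  "sorted_wrt (\<lambda>a b. (a \<notin> set P \<longrightarrow> a \<noteq> b) \<and>
     (\<forall>i j. i < length P \<and> j < length P \<and> a = P ! i \<and> b = P ! j \<longrightarrow> i \<le> j)) search"
    (is "sorted_wrt ?R search")
  unfolding search_def
proof (rule sorted_wrt_sweep)
  fix x assume "x \<in> set inner"
  then have x: "x \<in> set P" using set_inner_subset by blast
  show "sorted_wrt ?R (detour attached_list x)"
    by (rule sorted_wrt_detour) (use x P_nth_eq in \<open>auto simp: attached_def\<close>)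
next
  show "sorted_wrt (\<lambda>x y. \<forall>a\<in>insert x (set (attached_list x)). \<forall>b\<in>insert y (set (attached_list y)). ?R a b) inner"
    unfolding sorted_wrt_iff_nth_less
  proof (intro allI impI ballI)
    fix k l a b
    assume kl: "k < l" "l < length inner"
      and a: "a \<in> insert (inner ! k) (set (attached_list (inner ! k)))"
      and b: "b \<in> insert (inner ! l) (set (attached_list (inner ! l)))"
    have k: "inner ! k = P ! Suc k" "Suc k < length P" and l: "inner ! l = P ! Suc l" "Suc l < length P"
      using kl nth_inner[of k] nth_inner[of l] length_inner by auto
    have "P ! Suc k \<noteq> P ! Suc l" using P_nth_eq[of "Suc k" "Suc l"] k l kl by simp
    then have "a \<noteq> b" if "a \<notin> set P"
      using that a b k l attached_unique[of "P ! Suc k" "P ! Suc l" a] nth_mem by (auto simp: attached_def)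
    moreover have "i \<le> j" if "i < length P" "j < length P" "a = P ! i" "b = P ! j" for i j
    proof -
      have "a = P ! Suc k" "b = P ! Suc l" using a b that k l by (auto simp: attached_def)
      then have "i = Suc k" "j = Suc l" using that k l P_nth_eq by simp_all
      then show ?thesis using kl by simp
    qed
    ultimately show "?R a b" by blast
  qed
qed

lemma linear_search_along_search: "linear_search_along G P search"
  unfolding linear_search_along_def
proof (intro conjI)
  show "vwalk search G" "hd search = P ! 1" by (rule vwalk_search, rule hd_search)
  show "last search = P ! (vwalk_length P - 1)"
    using last_search by (simp add: numeral_2_eq_2)
  show "\<forall>v\<in>verts G. \<not> leaf G v \<longrightarrow> v \<in> set search"
    by (simp add: set_search nonleaves_def)
  show "\<forall>i. Suc i < length search \<longrightarrow> search ! i \<in> set P \<or> search ! Suc i \<in> set P"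
  \<comment> \<open>All entries are nonleaves, and the only nonleaf neighbour of an attached vertex
    lies on \<open>P\<close>.\<close>
  proof (intro allI impI, rule disjCI)
    fix i assume i: "Suc i < length search" and off: "search ! Suc i \<notin> set P"
    have N: "search ! i \<in> nonleaves G" "search ! Suc i \<in> nonleaves G" and adj: "search ! i \<rightarrow> search ! Suc i"
      using i vwalk_search nth_mem[of i search] nth_mem[of "Suc i" search] by (simp_all add: set_search vwalk_iff_nth)
    obtain x where x: "x \<in> set inner" "search ! Suc i \<in> attached x"
      using nonleaf_inner_or_attached[OF N(2)] off set_inner_subset by blast
    have "search ! i \<in> {y \<in> nonleaves G. search ! Suc i \<rightarrow> y}" using N(1) adj_sym[OF adj] by simp
    then have "search ! i = x" unfolding attached_nonleaf_neighbours[OF x] by simp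
    then show "search ! i \<in> set P" using x(1) set_inner_subset by blast
  qed
  note order = sorted_wrt_nth_less[OF search_order]
  show "\<forall>i j. i < j \<and> j < length search \<and> search ! i \<notin> set P \<longrightarrow> search ! i \<noteq> search ! j"
  proof (intro allI impI, elim conjE)
    fix i j assume ij: "i < j" "j < length search" and off: "search ! i \<notin> set P"
    from conjunct1[OF order[OF ij]] off show "search ! i \<noteq> search ! j" ..
  qed
  show "\<forall>i j a b. i < j \<and> j < length search \<and> a < length P \<and> b < length P \<and>
        search ! i = P ! a \<and> search ! j = P ! b \<longrightarrow> a \<le> b"
  proof (intro allI impI, elim conjE)
    fix i j a b
    assume ij: "i < j" "j < length search" and ab: "a < length P" "b < length P" "search ! i = P ! a" "search ! j = P ! b"
    from conjunct2[OF order[OF ij]] ab show "a \<le> b" by blast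
  qed
qed

text \<open>With the prince inside the detour at \<open>q\<close>, an already visited
  \<open>x\<close> is attached to an earlier vertex, belongs to the current detour, or is an earlier
  inner vertex. Its nonleaf neighbours have been visited in each case, except when
  \<open>y = q\<close> has not yet been reached or when \<open>x = q\<close> during its own detour;
  there the colours decide.\<close>

lemma search_progress:
  assumes c: "proper_2_colouring G c"
    and j: "j < length search" and x: "x \<in> set (take j search)" "search ! j \<noteq> x" "c (search ! j) = c x"
    and y: "x \<rightarrow> y" "\<not> leaf G y"
  shows "y \<in> set (take j search)"
proof -
  have "sweep attached_list inner = take j search @ search ! j # drop (Suc j) search"
    using id_take_nth_drop[OF j] by (simp add: search_def)
  from sweep_eq_append_Cons[OF this] obtain Q1 q Q2 us vs where
    Q: "inner = Q1 @ q # Q2" and d: "detour attached_list q = us @ search ! j # vs"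
    and t: "take j search = sweep attached_list Q1 @ us" by blast
  have diff: "c u \<noteq> c v" if "u \<rightarrow> v" for u v using c that by (auto simp: proper_2_colouring_def)
  have t: "set (take j search) = (\<Union>x\<in>set Q1. insert x (attached x)) \<union> set us"
    unfolding t by (simp add: set_sweep)
  have qi: "q \<in> set inner" and Q1i: "set Q1 \<subseteq> set inner" using Q by auto
  have yN: "y \<in> nonleaves G" using y adj_in_verts(2) by (simp add: nonleaves_def)
  have us: "us = [] \<and> search ! j = q \<or> q \<in> set us \<and> set us \<subseteq> insert q (attached q) \<and> search ! j \<in> insert q (attached q)"
  proof (cases us)
    case Nil
    then show ?thesis using d by (simp add: detour_def)
  next
    case (Cons u us')
    have "set us \<subseteq> insert q (attached q)" "search ! j \<in> insert q (attached q)"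
      using arg_cong[OF d, of set] by (auto simp: set_detour)
    moreover have "u = q" using d Cons by (simp add: detour_def)
    ultimately show ?thesis using Cons by simp
  qed
  have att: "y = z" if "z \<in> set inner" "x \<in> attached z" for z
    using attached_nonleaf_neighbours[OF that] yN y(1) by blast
  consider (earlier) "x \<in> set Q1" | (side) z where "z \<in> set Q1" "x \<in> attached z" | (here) "x \<in> set us"
    using x(1) unfolding t by blast
  then show ?thesis
  proof cases
    case side
    then have "y = z" using att Q1i by blast
    then show ?thesis using side unfolding t by blast
  next
    case here
    then have us: "q \<in> set us" "x \<in> insert q (attached q)" "search ! j \<in> insert q (attached q)"
      using us by auto
    show ?thesis
    proof (cases "x = q")
      case True
      \<comment> \<open>The prince is then on a side vertex, whose colour is opposite to that of
        \<open>q = x\<close>.\<close>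
      then have "q \<rightarrow> search ! j" using us(3) x(2) by (auto simp: attached_def)
      then show ?thesis using diff x(3) True by metis
    next
      case False
      then have "y = q" using us(2) att qi by blast
      then show ?thesis using us(1) unfolding t by blast
    qed
  next
    case earlier
    show ?thesis
    proof (cases "y \<in> set P")
      case False
      then have "y \<in> attached x" using y unfolding attached_def by blast
      then show ?thesis using earlier unfolding t by blast
    next
      case True
      then have "y \<in> set inner" using nonleaf_on_P_inner yN by blast
      then obtain l where l: "l < length inner" "y = inner ! l" by (auto simp: in_set_conv_nth)
      obtain k where k: "k < length Q1" "x = Q1 ! k" using earlier by (auto simp: in_set_conv_nth)
      then have k': "k < length inner" "x = inner ! k" by (simp_all add: Q nth_append)
      have "P ! Suc k \<rightarrow> P ! Suc l" using y(1) k' l nth_inner by simp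
      then have "l = Suc k \<or> k = Suc l"
        using P_neighbours[of "Suc k" "Suc l"] k'(1) l(1) length_inner by auto
      then consider "l < length Q1" | "l = length Q1" using k(1) by linarith
      then show ?thesis
      proof cases
        case 1
        then have "y \<in> set Q1" using l Q by (simp add: nth_append)
        then show ?thesis unfolding t by blast
      next
        case 2
        then have "y = q" using l Q by simp
        \<comment> \<open>The prince has the colour of \<open>x\<close>, hence is not at its
          neighbour \<open>q\<close>; so the detour has already left \<open>q\<close>.\<close>
        then have "q \<in> set us" using us diff[OF y(1)] x(3) by auto
        then show ?thesis using \<open>y = q\<close> unfolding t by blast
      qed
    qed
  qed
qed

section \<open>Success of the linear strategy\<close>

lemma search_catches:
  assumes "proper_2_colouring G c" "vwalk ws G" "length ws = length search" "c (hd ws) = c (hd search)"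
  shows "\<exists>i < length search. ws ! i = search ! i"
  by (rule search_meets_walk[OF assms(1) vwalk_search _ _ _ _ assms(2-4)])
    (use search_progress[OF assms(1)] set_search has_neighbour connected_leaf_neighbour[OF connected card_verts] in \<open>blast+\<close>)

lemma strategy_search: "search \<noteq> []" "set search \<subseteq> verts G"
  using vwalk_search by (simp_all add: vwalk_def)

text \<open>The second search starts at the vertex where the first one ends. Staying there for a day
  shifts the prince against the colouring, so a princess of the wrong colour during the first search
  has the right one during the second.\<close>

lemma linear_strategy_exists:
  "\<exists>ps. linear_strategy G P ps \<and> winning G ps \<and> length ps = 2 * length search"
proof -
  interpret R: palace G "rev P" by (rule palace_rev)
  let ?s = search and ?t = "R.search"
  \<comment> \<open>Both lengths, increased by 2, equal a sum that does not mention the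
    path.\<close>
  have len: "length ?t = length ?s" using card_reduction_eq R.card_reduction_eq by simp
  obtain c where c: "proper_2_colouring G c" using solvable_2_colourable[OF solvable] by blast
  have turn: "hd ?t = last ?s"
    using R.hd_search last_search length_P by (simp add: rev_nth numeral_2_eq_2)
  have "linear_strategy G P (?s @ ?t)"
    unfolding linear_strategy_def linear_search_def opposite_parity_def
    using linear_search_along_search R.linear_search_along_search c turn by metis
  moreover have "winning G (?s @ ?t)"
    unfolding winning_def strategy_def
  proof (intro conjI allI impI)
    show "?s @ ?t \<noteq> []" "set (?s @ ?t) \<subseteq> verts G"
      using strategy_search R.strategy_search by simp_all
    fix ws assume ws: "vwalk ws G \<and> length ws = length (?s @ ?t)"
    define n where "n = length ?s"
    have n: "0 < n" "length ws = n + n" using strategy_search(1) ws len by (simp_all add: n_def)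
    have ne: "take n ws \<noteq> []" "drop n ws \<noteq> []" using n by auto
    have "vwalk (take n ws @ drop n ws) G" using ws by simp
    then have parts: "vwalk (take n ws) G" "vwalk (drop n ws) G" "last (take n ws) \<rightarrow> hd (drop n ws)"
      using vwalk_append_iff[OF ne] by simp_all
    show "\<exists>i<length (?s @ ?t). ws ! i = (?s @ ?t) ! i"
    proof (cases "c (hd (take n ws)) = c (hd ?s)")
      case True
      then obtain i where "i < n" "take n ws ! i = ?s ! i"
        using search_catches[OF c parts(1)] n by (auto simp: n_def)
      then show ?thesis by (intro exI[of _ i]) (simp add: nth_append n_def)
    next
      case False
      have "c (ws ! i) \<noteq> c (?s ! i)" if "i < n" for i
        using that
      proof (induction i)
        case 0
        then show ?case using False ne(1) n(1) strategy_search(1) by (simp add: hd_conv_nth)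
      next
        case (Suc i)
        have "ws ! i \<rightarrow> ws ! Suc i" "?s ! i \<rightarrow> ?s ! Suc i"
          using ws vwalk_search Suc.prems n by (simp_all add: vwalk_iff_nth n_def)
        then show ?case using c Suc by (auto simp: proper_2_colouring_def)
      qed
      from this[of "n - 1"] have "c (last (take n ws)) \<noteq> c (last ?s)"
        using n strategy_search(1) ne(1) by (simp add: last_conv_nth n_def min_def)
      then have "c (hd (drop n ws)) = c (hd ?t)"
        using c parts(3) turn by (auto simp: proper_2_colouring_def)
      then obtain i where "i < n" "drop n ws ! i = ?t ! i"
        using R.search_catches[OF c parts(2)] n len by (auto simp: n_def)
      then show ?thesis using n len by (intro exI[of _ "n + i"]) (simp add: nth_append n_def)
    qed
  qed
  ultimately show ?thesis using len by (intro exI[of _ "?s @ ?t"]) simp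
qed

end

theorem theorem5:
  fixes G H :: "('a, 'b) pre_digraph" and m :: nat
  assumes "graph G"
    and "connected G"
    and "solvable G"
    and "is_reduction G H"
    and "card (verts H) = m"
    and "m \<ge> 3"
  shows "(\<forall>P. longest_path G P \<longrightarrow>
            (\<exists>ps. linear_strategy G P ps \<and> winning G ps \<and> length ps = 2 * m - 4)) \<and>
         (\<nexists>ps. winning G ps \<and> length ps < 2 * m - 4)"
proof -
  interpret graph G by fact
  have steps: "reduction_step\<^sup>*\<^sup>* G H" using assms(4) by (simp add: is_reduction_def)
  have card: "3 \<le> card (verts G)"
    using card_mono[OF finite_verts reduction_verts_subset[OF steps]] assms(5,6) by simp
  have palace: "palace G P" if "longest_path G P" for P
    using assms(1-3) that card by (intro palace.intro palace_axioms.intro)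
  \<comment> \<open>One search takes \<open>m - 2\<close> days along every longest path, so both
    bounds become \<open>2 * m - 4\<close>.\<close>
  have m: "length (palace.search G P) + 2 = m" if "longest_path G P" for P
    using card_reduction[OF assms(2,4)] assms(5,6) palace.card_reduction_eq[OF palace[OF that]] by simp
  have "\<exists>ps. linear_strategy G P ps \<and> winning G ps \<and> length ps = 2 * m - 4" if "longest_path G P" for P
    using palace.linear_strategy_exists[OF palace[OF that]] m[OF that] by (metis add_diff_cancel_right' diff_mult_distrib2 mult_2_right numeral_Bit0)
  moreover have "2 * m - 4 \<le> length ps" if "winning G ps" for ps
  proof -
    obtain P where P: "longest_path G P" using longest_path_exists[OF assms(1,2)] by blast
    then show ?thesis using palace.winning_length_ge[OF palace[OF P] that] m[OF P] by simp
  qed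
  ultimately show ?thesis by (meson linorder_not_less)
qed

end
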